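(* For any $n\in\mathbb{N}$, there exists a Lipschitz domain $\Omega\subset\mathbb{CP}^n$ such that for every open neighborhood $U$ of $\partial\Omega$ and every $0<\eta<1$, the function $-\delta^\eta$ fails to be plurisubharmonic on $U\cap\Omega$, where $\delta(z)=\inf_{w\in\partial\Omega}\operatorname{dist}(z,w)$ is the Fubini-Study distance to the boundary.
   Context: $\mathbb{CP}^n$ carries the Fubini-Study metric with K\"ahler form $\omega=i\partial\bar\partial\log|w|$ ($|\cdot|$ the Euclidean length in $\mathbb{C}^{n+1}$), whose distance is $\operatorname{dist}(p,q)=\arccos\left(\frac{|p\cdot\bar q|}{|p||q|}\right)$, where $a\cdot b=\sum_k a^kb^k$; $B(p,R)$ is the ball of radius $R$ about $p$ for this distance. A domain is a nonempty, open, connected set; it is assumed here to have nonempty boundary. On $\{z\in\mathbb{CP}^n:z^{n+1}\neq0\}$ use the coordinates $\tilde z=(z^1/z^{n+1},\ldots,z^n/z^{n+1})$ and write $\tilde z'=(\tilde z^1,\ldots,\tilde z^{n-1})$. $\Omega$ is a Lipschitz domain if for every $p\in\partial\Omega$ there is a rotation (unitary map of $\mathbb{C}^{n+1}$) taking $p$ to $[0:\cdots:0:1]$ such that, in these coordinates, for some $R>0$ and some Lipschitz function $\varphi$, $\Omega\cap B(p,R)=\{z\in B(p,R):\operatorname{Im}\tilde z^n<\varphi(\tilde z',\operatorname{Re}\tilde z^n)\}$. *)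

theory Defs
  imports "HOL-Analysis.Analysis"
begin

section \<open>Complex projective space with the Fubini-Study distance\<close>

text \<open>
  The type \<open>'n cp\<close> is \<open>n\<close>-dimensional complex projective space for \<open>n = CARD('n) \<ge> 1\<close>.  Homogeneous
  coordinates are indexed by \<open>'n option\<close>, which has \<open>n + 1\<close> elements: \<open>None\<close> is the index of the
  last coordinate (the one inverted in the affine chart), and the \<open>Some i\<close> are the indices of the
  first \<open>n\<close> coordinates.
\<close>

definition proj_rel :: "complex^'k \<Rightarrow> complex^'k \<Rightarrow> bool" where
  "proj_rel z w \<longleftrightarrow> z \<noteq> 0 \<and> w \<noteq> 0 \<and> (\<exists>c. c \<noteq> 0 \<and> w = c *s z)"

lemma part_equivp_proj_rel: "part_equivp (proj_rel :: complex^'k \<Rightarrow> _)"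
proof (rule part_equivpI)
  have "(1 :: complex^'k) \<noteq> 0" by simp
  then have "proj_rel (1 :: complex^'k) 1"
    unfolding proj_rel_def by (intro conjI exI[of _ 1]) auto
  then show "\<exists>x :: complex^'k. proj_rel x x" by blast
  show "symp (proj_rel :: complex^'k \<Rightarrow> _)"
  proof (rule sympI)
    fix z w :: "complex^'k" assume "proj_rel z w"
    then obtain c where "z \<noteq> 0" "w \<noteq> 0" "c \<noteq> 0" "w = c *s z" unfolding proj_rel_def by blast
    moreover from this have "z = inverse c *s w" by (simp add: vector_smult_assoc)
    ultimately show "proj_rel w z"
      unfolding proj_rel_def by (metis inverse_nonzero_iff_nonzero)
  qed
  show "transp (proj_rel :: complex^'k \<Rightarrow> _)"
  proof (rule transpI)
    fix x y z :: "complex^'k" assume "proj_rel x y" "proj_rel y z"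
    then show "proj_rel x z"
      unfolding proj_rel_def by (metis mult_eq_0_iff vector_smult_assoc)
  qed
qed

quotient_type (overloaded) 'n cp = "complex^('n::finite option)" / partial: proj_rel
  by (rule part_equivp_proj_rel)

text \<open>The Hermitian product \<open>a \<cdot> cnj b\<close> on homogeneous coordinates.\<close>

definition hdot :: "complex^'k \<Rightarrow> complex^'k \<Rightarrow> complex" where
  "hdot a b = (\<Sum>k\<in>UNIV. a $ k * cnj (b $ k))"

definition fs_dist :: "complex^'k \<Rightarrow> complex^'k \<Rightarrow> real" where
  "fs_dist z w = arccos (cmod (hdot z w) / (norm z * norm w))"

lemma hdot_simps:
  "hdot (a + b) c = hdot a c + hdot b c"
  "hdot (a - b) c = hdot a c - hdot b c"
  "hdot c (a + b) = hdot c a + hdot c b"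
  "hdot c (a - b) = hdot c a - hdot c b"
  "hdot (s *s a) c = s * hdot a c"
  "hdot c (s *s a) = cnj s * hdot c a"
  by (simp_all add: hdot_def algebra_simps sum.distrib sum_subtractf sum_distrib_left)

lemma hdot_commute: "hdot b a = cnj (hdot a b)"
  by (simp add: hdot_def mult.commute)

lemma hdot_self: "hdot a a = of_real ((norm a)\<^sup>2)"
proof -
  have "(norm a)\<^sup>2 = (\<Sum>k\<in>UNIV. (cmod (a $ k))\<^sup>2)"
    by (simp add: norm_vec_def L2_set_def sum_nonneg)
  then show ?thesis
    by (simp only: hdot_def of_real_sum complex_norm_square)
qed

lemma norm_smult_vec: "norm (s *s a) = cmod s * norm (a :: complex^'k)"
proof -
  have "complex_of_real ((norm (s *s a))\<^sup>2) = of_real ((cmod s * norm a)\<^sup>2)"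
    unfolding hdot_self[symmetric] hdot_simps
    by (simp only: hdot_self power_mult_distrib of_real_mult complex_norm_square mult_ac)
  then have "(norm (s *s a))\<^sup>2 = (cmod s * norm a)\<^sup>2" using of_real_eq_iff by blast
  then show ?thesis by (simp add: power2_eq_iff_nonneg)
qed

lemma hdot_Cauchy_Schwarz: "cmod (hdot a b) \<le> norm a * norm b"
proof -
  have "cmod (hdot a b) \<le> (\<Sum>k\<in>UNIV. cmod (a $ k) * cmod (b $ k))"
    unfolding hdot_def by (rule order_trans[OF norm_sum]) (simp add: norm_mult)
  also have "\<dots> = (\<Sum>k\<in>UNIV. \<bar>cmod (a $ k)\<bar> * \<bar>cmod (b $ k)\<bar>)" by simp
  also have "\<dots> \<le> norm a * norm b"
    unfolding norm_vec_def by (rule L2_set_mult_ineq)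
  finally show ?thesis .
qed

lemma fs_dist_commute: "fs_dist z w = fs_dist w z"
  unfolding fs_dist_def by (subst hdot_commute) (simp add: mult.commute)

lemma fs_dist_smult:
  assumes "c \<noteq> 0" "d \<noteq> 0"
  shows "fs_dist (c *s z) (d *s w) = fs_dist z w"
  using assms by (simp add: fs_dist_def hdot_simps norm_smult_vec norm_mult)

lemma fs_dist_arg:
  assumes "z \<noteq> 0" "w \<noteq> 0"
  shows "0 \<le> cmod (hdot z w) / (norm z * norm w)" "cmod (hdot z w) / (norm z * norm w) \<le> 1"
  using assms hdot_Cauchy_Schwarz[of z w] by (simp_all add: divide_le_eq)

lemma exists_unit_rep:
  assumes "z \<noteq> (0 :: complex^'k)"
  obtains c where "c \<noteq> 0" "norm (c *s z) = 1"
proof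
  show "complex_of_real (inverse (norm z)) \<noteq> 0" using assms by simp
  show "norm (complex_of_real (inverse (norm z)) *s z) = 1"
    using assms by (simp add: norm_smult_vec norm_inverse)
qed

lemma norm_hdot_proj:
  assumes "norm p = 1" "norm q = 1"
  shows "(norm (p - hdot p q *s q))\<^sup>2 = 1 - (cmod (hdot p q))\<^sup>2"
proof -
  have pq: "hdot p p = 1" "hdot q q = 1" using assms by (simp_all add: hdot_self)
  have "complex_of_real ((norm (p - hdot p q *s q))\<^sup>2) = 1 - hdot p q * cnj (hdot p q)"
    unfolding hdot_self[symmetric]
    by (simp add: hdot_simps pq hdot_commute[of q p] algebra_simps)
  also have "\<dots> = of_real (1 - (cmod (hdot p q))\<^sup>2)"
    by (simp only: of_real_diff of_real_1 complex_norm_square)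
  finally show ?thesis using of_real_eq_iff by blast
qed

lemma fs_dist_triangle_unit:
  assumes "norm p = 1" "norm q = 1" "norm r = 1"
  shows "fs_dist p r \<le> fs_dist p q + fs_dist q r"
proof -
  define a where "a = hdot p q"
  define b where "b = hdot r q"
  define c where "c = cmod a"
  define d where "d = cmod b"
  define x where "x = p - a *s q"
  define y where "y = r - b *s q"
  have c: "0 \<le> c" "c \<le> 1" and d: "0 \<le> d" "d \<le> 1"
    using hdot_Cauchy_Schwarz[of p q] hdot_Cauchy_Schwarz[of r q] assms
    by (simp_all add: a_def b_def c_def d_def)
  have nx: "norm x = sqrt (1 - c\<^sup>2)"
    using norm_hdot_proj[OF assms(1,2)] unfolding x_def a_def c_def by (metis norm_ge_zero real_sqrt_unique)
  have ny: "norm y = sqrt (1 - d\<^sup>2)"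
    using norm_hdot_proj[OF assms(3,2)] unfolding y_def b_def d_def by (metis norm_ge_zero real_sqrt_unique)
  have qq: "hdot q q = 1" using assms by (simp add: hdot_self)
  have "hdot p r = a * cnj b + hdot x y"
    unfolding x_def y_def
    by (simp add: hdot_simps qq a_def b_def hdot_commute[of q r] algebra_simps)
  then have "cmod (hdot p r) \<ge> cmod (a * cnj b) - cmod (hdot x y)"
    by (metis norm_diff_ineq)
  moreover have "cmod (hdot x y) \<le> sqrt (1 - c\<^sup>2) * sqrt (1 - d\<^sup>2)"
    using hdot_Cauchy_Schwarz[of x y] nx ny by simp
  ultimately have "c * d - sqrt (1 - c\<^sup>2) * sqrt (1 - d\<^sup>2) \<le> cmod (hdot p r)"
    by (simp add: c_def d_def norm_mult)
  moreover have "cos (arccos c + arccos d) = c * d - sqrt (1 - c\<^sup>2) * sqrt (1 - d\<^sup>2)"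
    using c d by (simp add: cos_add sin_arccos)
  ultimately have le: "cos (arccos c + arccos d) \<le> cmod (hdot p r)" by simp
  have le1: "cmod (hdot p r) \<le> 1" using hdot_Cauchy_Schwarz[of p r] assms by simp
  have "arccos c \<le> pi / 2" "arccos d \<le> pi / 2" "0 \<le> arccos c" "0 \<le> arccos d"
    using c d arccos_le_pi2[of c] arccos_le_pi2[of d] arccos_lbound[of c] arccos_lbound[of d] by linarith+
  then have "arccos (cos (arccos c + arccos d)) = arccos c + arccos d"
    by (intro arccos_cos) auto
  moreover have "arccos (cmod (hdot p r)) \<le> arccos (cos (arccos c + arccos d))"
    using le le1 by (intro arccos_le_mono[THEN iffD2]) (auto simp: abs_le_iff intro: order_trans)
  moreover have "cmod (hdot q r) = d"
    by (simp add: d_def b_def hdot_commute[of q r])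
  ultimately show ?thesis
    using assms by (simp add: fs_dist_def c_def a_def)
qed

lemma fs_dist_triangle:
  assumes "p \<noteq> 0" "q \<noteq> 0" "r \<noteq> 0"
  shows "fs_dist p r \<le> fs_dist p q + fs_dist q r"
proof -
  obtain a b c where
    "a \<noteq> 0" "b \<noteq> 0" "c \<noteq> 0" "norm (a *s p) = 1" "norm (b *s q) = 1" "norm (c *s r) = 1"
    using exists_unit_rep assms by metis
  then show ?thesis
    using fs_dist_triangle_unit[of "a *s p" "b *s q" "c *s r"] by (simp add: fs_dist_smult)
qed

lemma fs_dist_eq_0_unit:
  assumes "norm p = 1" "norm q = 1" "fs_dist p q = 0"
  shows "p = hdot p q *s q"
proof -
  have "cmod (hdot p q) \<le> 1" using hdot_Cauchy_Schwarz[of p q] assms by simp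
  then have "cmod (hdot p q) = 1"
    using assms cos_arccos[of "cmod (hdot p q)"] norm_ge_zero[of "hdot p q"]
    by (simp add: fs_dist_def del: norm_ge_zero)
  then show ?thesis using norm_hdot_proj[OF assms(1,2)] by simp
qed

lemma fs_dist_eq_0_iff:
  assumes "z \<noteq> 0" "w \<noteq> 0"
  shows "fs_dist z w = 0 \<longleftrightarrow> proj_rel z w"
proof
  assume "proj_rel z w"
  then obtain c where c: "c \<noteq> 0" "w = c *s z" unfolding proj_rel_def by blast
  then show "fs_dist z w = 0"
    using assms by (simp add: fs_dist_def hdot_simps hdot_self norm_smult_vec norm_mult power2_eq_square)
next
  assume z: "fs_dist z w = 0"
  obtain a b where ab: "a \<noteq> 0" "b \<noteq> 0" "norm (a *s z) = 1" "norm (b *s w) = 1"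
    using exists_unit_rep assms by metis
  define h where "h = hdot (a *s z) (b *s w)"
  have eq: "a *s z = h *s (b *s w)"
    unfolding h_def using ab z by (intro fs_dist_eq_0_unit) (simp_all add: fs_dist_smult)
  have h: "h \<noteq> 0" using eq ab by auto
  have "w = (inverse b * inverse h * a) *s z"
  proof -
    have "(inverse b * inverse h) *s (a *s z) = (inverse b * inverse h) *s (h *s (b *s w))"
      using eq by simp
    then show ?thesis using ab h by (simp add: vector_smult_assoc field_simps)
  qed
  then show "proj_rel z w"
    unfolding proj_rel_def using assms ab h
    by (intro conjI exI[of _ "inverse b * inverse h * a"]) auto
qed

instantiation cp :: (finite) metric_space
begin

lift_definition dist_cp :: "'a cp \<Rightarrow> 'a cp \<Rightarrow> real" is fs_dist
  by (auto simp: proj_rel_def fs_dist_smult)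

definition uniformity_cp :: "('a cp \<times> 'a cp) filter" where
  "uniformity_cp = (INF e\<in>{0 <..}. principal {(x, y). dist x y < e})"

definition open_cp :: "'a cp set \<Rightarrow> bool" where
  "open_cp U \<longleftrightarrow> (\<forall>x\<in>U. eventually (\<lambda>(x', y). x' = x \<longrightarrow> y \<in> U) uniformity)"

instance
proof
  fix x y z :: "'a cp"
  show "dist x y = 0 \<longleftrightarrow> x = y"
    by transfer (auto simp: proj_rel_def fs_dist_eq_0_iff)
  have comm: "dist y z = dist z y"
    by transfer (rule fs_dist_commute)
  have "dist x y \<le> dist x z + dist z y"
    by transfer (auto simp: proj_rel_def intro: fs_dist_triangle)
  then show "dist x y \<le> dist x z + dist y z" using comm by simp
qed (rule uniformity_cp_def open_cp_def)+

end

section \<open>Rotations and affine coordinates\<close>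

text \<open>The class \<open>[z]\<close> of a nonzero vector is \<open>abs_cp z\<close>.\<close>

definition unitary_matrix :: "complex^'k^'k \<Rightarrow> bool" where
  "unitary_matrix A \<longleftrightarrow> (\<chi> i j. cnj (A $ j $ i)) ** A = mat 1"

text \<open>For unitary (indeed invertible) \<open>A\<close> this does not depend on the representative; see
  \<open>rotate_abs_cp\<close>.\<close>

definition rotate_cp :: "complex^('n option)^('n option) \<Rightarrow> 'n::finite cp \<Rightarrow> 'n cp" where
  "rotate_cp A p = abs_cp (A *v rep_cp p)"

lemma rotate_abs_cp:
  assumes "unitary_matrix A" "z \<noteq> 0"
  shows "rotate_cp A (abs_cp z) = abs_cp (A *v z)"
proof -
  have nz: "A *v v \<noteq> 0" if "v \<noteq> 0" for v
  proof
    assume "A *v v = 0"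
    then have "((\<chi> i j. cnj (A $ j $ i)) ** A) *v v = 0"
      by (simp flip: matrix_vector_mul_assoc)
    then show False using assms that by (simp add: unitary_matrix_def)
  qed
  have "1 *s z = z" by simp
  then have "proj_rel z z" unfolding proj_rel_def using assms(2) by (metis zero_neq_one)
  then have "proj_rel (rep_cp (abs_cp z)) z"
    using Quotient_rep_abs[OF Quotient_cp] by blast
  then obtain c where c: "c \<noteq> 0" "z = c *s rep_cp (abs_cp z)" "rep_cp (abs_cp z) \<noteq> 0"
    unfolding proj_rel_def by blast
  have "A *v z = c *s (A *v rep_cp (abs_cp z))"
    by (subst c(2)) (rule vector_scalar_commute)
  then have "proj_rel (A *v rep_cp (abs_cp z)) (A *v z)"
    unfolding proj_rel_def using nz[OF assms(2)] nz[OF c(3)] c(1) by blast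
  then show ?thesis
    unfolding rotate_cp_def by (rule Quotient_rel_abs[OF Quotient_cp])
qed

lift_definition in_chart :: "'n::finite cp \<Rightarrow> bool" is "\<lambda>z. z $ None \<noteq> 0"
  by (auto simp: proj_rel_def)

lift_definition affine_coords :: "'n::finite cp \<Rightarrow> complex^'n" is
  "\<lambda>z. \<chi> i. z $ Some i / z $ None"
  by (auto simp: proj_rel_def vec_eq_iff)

definition affine_point :: "complex^'n \<Rightarrow> 'n::finite cp" where
  "affine_point v = abs_cp (\<chi> k. case k of None \<Rightarrow> 1 | Some i \<Rightarrow> v $ i)"

lemma affine_point_0: "affine_point 0 = abs_cp (axis None 1)"
  unfolding affine_point_def
  by (rule arg_cong[where f = abs_cp]) (auto simp: vec_eq_iff axis_def split: option.splits)

section \<open>Lipschitz domains\<close>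

definition domain_cp :: "'n::finite cp set \<Rightarrow> bool" where
  "domain_cp \<Omega> \<longleftrightarrow> \<Omega> \<noteq> {} \<and> open \<Omega> \<and> connected \<Omega> \<and> frontier \<Omega> \<noteq> {}"

definition last_index :: "'n::{finite,linorder}" where
  "last_index = Max UNIV"

text \<open>
  The tuple of the first \<open>n - 1\<close> coordinates is encoded by setting the \<open>n\<close>-th coordinate to zero,
  so \<open>\<complex>\<^sup>n\<^sup>-\<^sup>1\<close> becomes (isometrically) the subspace of all \<open>v\<close> with \<open>v $ last_index = 0\<close>.
\<close>

definition first_coords :: "complex^('n::{finite,linorder}) \<Rightarrow> complex^('n::{finite,linorder})" where
  "first_coords v = (\<chi> i. if i = last_index then 0 else v $ i)"

text \<open>
  The inclusion of the rotated ball in the affine chart (that is, \<open>R \<le> pi / 2\<close>) makes the affine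
  coordinates meaningful on the whole ball; it only shrinks \<open>R\<close>.
\<close>

definition lipschitz_domain :: "'n::{finite,linorder} cp set \<Rightarrow> bool" where
  "lipschitz_domain \<Omega> \<longleftrightarrow> domain_cp \<Omega> \<and>
     (\<forall>p\<in>frontier \<Omega>. \<exists>A R L (\<phi> :: (complex^('n::{finite,linorder})) \<times> real \<Rightarrow> real).
        unitary_matrix A \<and> rotate_cp A p = abs_cp (axis None 1) \<and>
        0 < R \<and> (\<forall>z\<in>ball p R. in_chart (rotate_cp A z)) \<and>
        L-lipschitz_on ({v. v $ last_index = 0} \<times> UNIV) \<phi> \<and>
        \<Omega> \<inter> ball p R =
          {z \<in> ball p R. let w = affine_coords (rotate_cp A z) in
             Im (w $ last_index) < \<phi> (first_coords w, Re (w $ last_index))})"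

section \<open>Plurisubharmonic functions\<close>

definition usc_on :: "'a::topological_space set \<Rightarrow> ('a \<Rightarrow> real) \<Rightarrow> bool" where
  "usc_on D u \<longleftrightarrow> (\<forall>x\<in>D. \<forall>c>u x. \<forall>\<^sub>F y in at x within D. u y < c)"

text \<open>
  Real-valued plurisubharmonic functions on an open subset \<open>D\<close> of \<open>\<complex>\<^sup>n\<close>: upper semicontinuity and
  the sub-mean value inequality on all closed discs in complex lines that lie in \<open>D\<close>.  As \<open>u\<close> is
  bounded above on circles and finite at the centre, integrability is part of that inequality.
\<close>

definition psh_on :: "(complex^'n) set \<Rightarrow> (complex^'n \<Rightarrow> real) \<Rightarrow> bool" where
  "psh_on D u \<longleftrightarrow> usc_on D u \<and>
     (\<forall>a b. (\<forall>\<zeta>. cmod \<zeta> \<le> 1 \<longrightarrow> a + \<zeta> *s b \<in> D) \<longrightarrow>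
        set_integrable lborel {0..2*pi} (\<lambda>\<theta>. u (a + cis \<theta> *s b)) \<and>
        u a \<le> (1 / (2*pi)) * (LINT \<theta>:{0..2*pi}|lborel. u (a + cis \<theta> *s b)))"

text \<open>
  On an open subset of projective space, plurisubharmonicity is tested in the holomorphic atlas of
  all rotated affine charts, which contains the standard atlas (permutation matrices are unitary).
\<close>

definition psh_on_cp :: "'n::finite cp set \<Rightarrow> ('n cp \<Rightarrow> real) \<Rightarrow> bool" where
  "psh_on_cp W u \<longleftrightarrow>
     (\<forall>A. unitary_matrix A \<longrightarrow>
        psh_on {v. rotate_cp A (affine_point v) \<in> W} (\<lambda>v. u (rotate_cp A (affine_point v))))"

end

theory Submission
  imports Defs "HOL-Complex_Analysis.Cauchy_Integral_Formula"
begin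

text \<open>
  Write a point of projective space as \<open>[u]\<close> with \<open>u = (u', u\<^sub>n, u\<^sub>0)\<close>, where \<open>u\<^sub>0\<close> is the coordinate
  inverted in the affine chart, and put \<open>y = u\<^sub>n cnj u\<^sub>0\<close>.  The example is the complement of the lens
  \<open>K = {Re y + |Im y| + |u'|\<^sup>2 \<le> 0}\<close>, an intersection of two projective balls whose boundaries meet
  at the corner \<open>p = [0 : 0 : 1]\<close>.  Seen from the domain this corner is re-entrant.

  Why the domain fails: on the complex line \<open>z = [0 : x : 1]\<close> through the corner, and for \<open>x\<close> small in the
  sector \<open>|Im x| \<le> Re x\<close>, the nearest point of the lens is the corner, so \<open>\<delta>(z) = arctan |x|\<close>
  (\<open>infdist_ray_point\<close>).  The function \<open>ln |x|\<close> is harmonic and \<open>(arctan |x|)\<^sup>\<eta>\<close>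
  is a strictly convex function of \<open>ln |x|\<close> for small \<open>|x|\<close>, roughly \<open>exp (\<eta> ln |x|)\<close>.  Hence its mean
  over a small circle in the sector exceeds its value at the centre (\<open>circle_mean_arctan_powr\<close>), and
  \<open>-\<delta>\<^sup>\<eta>\<close> violates the sub-mean value inequality.  Such circles exist arbitrarily
  close to the corner, so inside every neighbourhood of the boundary.

  Why the domain is Lipschitz: the vector obtained from a boundary point by deleting \<open>u'\<close> and exchanging \<open>u\<^sub>n\<close> and \<open>u\<^sub>0\<close>
  is transversal, in the same sense, to every ball boundary through that point
  (\<open>lens_complement_transversal\<close>).  Turning it into the vertical direction by a unitary map gives a
  cone condition, and a set with a cone condition is locally the region below the graph of a
  Lipschitz function (\<open>subgraph_of_cone_condition\<close>).  The term \<open>|u'|\<^sup>2\<close> keeps \<open>u\<^sub>n\<close> and \<open>u\<^sub>0\<close> from vanishing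
  together on the lens; without it the transversal vector would degenerate there when \<open>n \<ge> 2\<close>.
\<close>

section \<open>Representatives and the topology of projective space\<close>

lemma proj_rel_refl: "u \<noteq> 0 \<Longrightarrow> proj_rel u u"
  unfolding proj_rel_def by (auto intro!: exI[of _ 1])

lemma dist_abs_cp:
  "u \<noteq> 0 \<Longrightarrow> w \<noteq> 0 \<Longrightarrow> dist (abs_cp u) (abs_cp w) = fs_dist u w"
  by (simp add: dist_cp.abs_eq proj_rel_refl)

lemma abs_cp_smult:
  assumes "c \<noteq> 0" "u \<noteq> 0"
  shows "abs_cp (c *s u) = abs_cp u"
proof -
  have "proj_rel u (c *s u)"
    using assms unfolding proj_rel_def by auto
  then show ?thesis
    by (metis Quotient_rel_abs[OF Quotient_cp])
qed

lemma obtain_unit_rep: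
  obtains u where "norm u = 1" "p = abs_cp u"
proof -
  obtain v where v: "v \<noteq> 0" "p = abs_cp v"
    by (metis Quotient_abs_rep[OF Quotient_cp] Quotient_rep_reflp[OF Quotient_cp] proj_rel_def)
  obtain c where "c \<noteq> 0" "norm (c *s v) = 1"
    using exists_unit_rep[OF v(1)] .
  then show ?thesis
    using that[of "c *s v"] v by (simp add: abs_cp_smult)
qed

lemma cos_fs_dist:
  assumes "u \<noteq> 0" "w \<noteq> 0"
  shows "cos (fs_dist u w) = cmod (hdot u w) / (norm u * norm w)"
  unfolding fs_dist_def using fs_dist_arg[OF assms] by (intro cos_arccos) linarith+

text \<open>
  Multiplying a representative of \<open>z\<close> by a phase makes its Hermitian product with \<open>u\<close> real and
  nonnegative, and then the Euclidean distance is determined by the angle.  So convergence in projective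
  space lifts to convergence of representatives.
\<close>

lemma obtain_close_rep:
  assumes "u \<noteq> 0"
  obtains w where "norm w = norm u" "z = abs_cp w"
    "(norm (w - u))\<^sup>2 = (norm u)\<^sup>2 * (2 - 2 * cos (dist (abs_cp u) z))"
proof -
  obtain v where v: "norm v = 1" "z = abs_cp v" using obtain_unit_rep .
  then have v0: "v \<noteq> 0" by auto
  \<comment> \<open>The phase that rotates the Hermitian product onto the nonnegative real axis.\<close>
  obtain c where c: "cmod c = 1" "c * hdot v u = cmod (hdot v u)"
  proof (cases "hdot v u = 0")
    case True then show ?thesis using that[of 1] by simp
  next
    case False
    have "cnj (hdot v u) * hdot v u = of_real ((cmod (hdot v u))\<^sup>2)"
      by (simp only: complex_norm_square mult.commute)
    then show ?thesis
      using that[of "cnj (hdot v u) / cmod (hdot v u)"] False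
      by (simp add: norm_divide power2_eq_square)
  qed
  define w where "w = (of_real (norm u) * c) *s v"
  have nw: "norm w = norm u"
    unfolding w_def using c v by (simp add: norm_smult_vec norm_mult)
  have "hdot w u = of_real (norm u) * (c * hdot v u)"
    by (simp add: w_def hdot_simps)
  also have "\<dots> = of_real ((norm u)\<^sup>2 * cos (fs_dist u v))"
    unfolding c(2) cos_fs_dist[OF assms v0] using assms
    by (subst hdot_commute) (simp add: v power2_eq_square)
  finally have h: "hdot w u = of_real ((norm u)\<^sup>2 * cos (fs_dist u v))" .
  have "complex_of_real ((norm (w - u))\<^sup>2) = of_real ((norm u)\<^sup>2 * (2 - 2 * cos (fs_dist u v)))"
    unfolding hdot_self[symmetric]
    by (simp add: hdot_simps hdot_commute[of u w] h hdot_self[of u] hdot_self[of w] nw algebra_simps)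
  then have "(norm (w - u))\<^sup>2 = (norm u)\<^sup>2 * (2 - 2 * cos (fs_dist u v))"
    using of_real_eq_iff by blast
  moreover have "z = abs_cp w"
    unfolding w_def v(2) using c assms v0 by (subst abs_cp_smult) auto
  moreover have "dist (abs_cp u) z = fs_dist u v"
    using assms v(2) v0 by (simp add: dist_abs_cp)
  ultimately show ?thesis
    using that[of w] nw by metis
qed

lemma open_abs_cp_image:
  assumes "open S" "0 \<notin> S"
  shows "open (abs_cp ` S)"
  unfolding open_dist
proof
  fix p :: "'a cp" assume "p \<in> abs_cp ` S"
  then obtain u where u: "u \<in> S" "p = abs_cp u" by blast
  with assms have u0: "u \<noteq> 0" by auto
  obtain e where e: "e > 0" "\<And>w. dist w u < e \<Longrightarrow> w \<in> S"
    using assms(1) u(1) unfolding open_dist by blast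
  have "((\<lambda>d. (norm u)\<^sup>2 * (2 - 2 * cos d)) \<longlongrightarrow> (norm u)\<^sup>2 * (2 - 2 * cos 0)) (at (0::real))"
    by (intro tendsto_intros)
  then have "\<forall>\<^sub>F d in at (0::real). (norm u)\<^sup>2 * (2 - 2 * cos d) < e\<^sup>2"
    by (rule order_tendstoD) (use e in simp)
  then obtain r where r: "r > 0"
    "\<And>d. d \<noteq> 0 \<Longrightarrow> \<bar>d\<bar> < r \<Longrightarrow> (norm u)\<^sup>2 * (2 - 2 * cos d) < e\<^sup>2"
    unfolding eventually_at by (auto simp: dist_real_def)
  have "z \<in> abs_cp ` S" if z: "dist z p < r" for z
  proof -
    obtain w where w: "z = abs_cp w"
      "(norm (w - u))\<^sup>2 = (norm u)\<^sup>2 * (2 - 2 * cos (dist (abs_cp u) z))"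
      using obtain_close_rep[OF u0] by metis
    have "(norm (w - u))\<^sup>2 < e\<^sup>2"
      unfolding w(2) using r(2)[of "dist (abs_cp u) z"] z u(2) e(1)
      by (cases "dist (abs_cp u) z = 0") (simp_all add: dist_commute)
    then have "norm (w - u) < e"
      using e(1) by (metis less_imp_le power_less_imp_less_base)
    then show ?thesis using e(2)[of w] w(1) by (simp add: dist_norm)
  qed
  then show "\<exists>e>0. \<forall>y. dist y p < e \<longrightarrow> y \<in> abs_cp ` S"
    using r(1) by blast
qed

lemma continuous_on_abs_cp: "continuous_on (- {0}) abs_cp"
  unfolding continuous_on_def
proof
  fix u :: "complex^('a option)" assume u: "u \<in> - {0}"
  have "continuous_on (- {0}) (\<lambda>w. fs_dist w u)"
    unfolding fs_dist_def hdot_def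
    using u fs_dist_arg[of _ u, unfolded hdot_def]
    by (intro continuous_on_arccos continuous_intros) (auto intro: order_trans[of _ 0])
  then have "((\<lambda>w. fs_dist w u) \<longlongrightarrow> fs_dist u u) (at u within - {0})"
    using u unfolding continuous_on_def by blast
  then have "((\<lambda>w. fs_dist w u) \<longlongrightarrow> 0) (at u within - {0})"
    using u fs_dist_eq_0_iff[of u u] proj_rel_refl[of u] by simp
  moreover have "\<forall>\<^sub>F w in at u within - {0}. fs_dist w u = dist (abs_cp w) (abs_cp u)"
    using u by (auto simp: eventually_at_filter dist_abs_cp)
  ultimately show "(abs_cp \<longlongrightarrow> abs_cp u) (at u within - {0})"
    by (subst tendsto_dist_iff) (simp add: filterlim_cong[OF refl refl, THEN iffD1])
qed

section \<open>Unitary matrices with two prescribed values\<close>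

definition orthonormal_on :: "'k set \<Rightarrow> ('k \<Rightarrow> complex^'k::finite) \<Rightarrow> bool" where
  "orthonormal_on S f \<longleftrightarrow> (\<forall>i\<in>S. \<forall>j\<in>S. hdot (f i) (f j) = (if i = j then 1 else 0))"

text \<open>
  The vectors orthogonal to a family indexed by \<open>S\<close> form the kernel of the square matrix whose rows in
  \<open>S\<close> are the conjugates of the family and whose other rows vanish.  A zero row makes the determinant
  vanish, so the kernel is nontrivial.
\<close>

lemma orthonormal_extend_one:
  fixes f :: "'k::finite \<Rightarrow> complex^'k"
  assumes f: "orthonormal_on S f" and k: "k \<notin> S"
  obtains v where "orthonormal_on (insert k S) (f(k := v))"
proof -
  define M :: "complex^'k^'k" where
    "M = (\<chi> i j. if i \<in> S then cnj (f i $ j) else 0)"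
  have "det M = 0"
    using k by (intro det_zero_row(1)[of k]) (simp add: M_def row_def vec_eq_iff)
  then have "\<not> invertible M"
    by (simp add: invertible_det_nz)
  then obtain x where x: "M *v x = 0" "x \<noteq> 0"
    unfolding invertible_left_inverse matrix_left_invertible_ker by blast
  obtain c where c: "norm (c *s x) = 1"
    using exists_unit_rep[OF x(2)] by metis
  have orth: "hdot (c *s x) (f i) = 0" if "i \<in> S" for i
  proof -
    have "hdot x (f i) = (M *v x) $ i"
      using that by (simp add: M_def hdot_def matrix_vector_mult_def mult.commute)
    then show ?thesis using x by (simp add: hdot_simps)
  qed
  have orth': "hdot (f i) (c *s x) = 0" if "i \<in> S" for i
    using orth[OF that] hdot_commute[of "f i" "c *s x"] by simp
  have one: "hdot (c *s x) (c *s x) = 1"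
    using c by (simp add: hdot_self)
  have "orthonormal_on (insert k S) (f(k := c *s x))"
    using f k orth orth' one unfolding orthonormal_on_def by auto
  then show ?thesis using that by blast
qed

lemma orthonormal_extend:
  fixes f :: "'k::finite \<Rightarrow> complex^'k"
  assumes "orthonormal_on S f"
  shows "\<exists>g. orthonormal_on UNIV g \<and> (\<forall>i\<in>S. g i = f i)"
proof -
  have "finite T \<Longrightarrow> T \<inter> S = {} \<Longrightarrow> \<exists>g. orthonormal_on (T \<union> S) g \<and> (\<forall>i\<in>S. g i = f i)" for T
  proof (induction T rule: finite_induct)
    case empty
    then show ?case using assms by auto
  next
    case (insert k T)
    then obtain g where g: "orthonormal_on (T \<union> S) g" "\<forall>i\<in>S. g i = f i" by auto
    have "k \<notin> T \<union> S" using insert by auto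
    then obtain v where "orthonormal_on (insert k (T \<union> S)) (g(k := v))"
      using orthonormal_extend_one[OF g(1)] by blast
    then have "orthonormal_on (insert k T \<union> S) (g(k := v))" by simp
    moreover have "\<forall>i\<in>S. (g(k := v)) i = f i" using g(2) insert by auto
    ultimately show ?case by blast
  qed
  from this[of "UNIV - S"] show ?thesis by auto
qed

definition adjoint_matrix :: "complex^'k^'k \<Rightarrow> complex^'k^'k" where
  "adjoint_matrix A = (\<chi> i j. cnj (A $ j $ i))"

lemma unitary_adjoint:
  assumes "unitary_matrix A"
  shows "adjoint_matrix A *v (A *v u) = u" "A *v (adjoint_matrix A *v u) = u"
proof -
  have 1: "adjoint_matrix A ** A = mat 1"
    using assms by (simp add: unitary_matrix_def adjoint_matrix_def)
  then have 2: "A ** adjoint_matrix A = mat 1"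
    by (simp add: matrix_left_right_inverse)
  show "adjoint_matrix A *v (A *v u) = u" "A *v (adjoint_matrix A *v u) = u"
    by (simp_all add: matrix_vector_mul_assoc 1 2)
qed

lemma hdot_adjoint: "hdot (A *v u) w = hdot u (adjoint_matrix A *v w)"
proof -
  have "hdot (A *v u) w = (\<Sum>k\<in>UNIV. \<Sum>j\<in>UNIV. A $ k $ j * u $ j * cnj (w $ k))"
    by (simp add: hdot_def matrix_vector_mult_def sum_distrib_right)
  also have "\<dots> = (\<Sum>j\<in>UNIV. \<Sum>k\<in>UNIV. A $ k $ j * u $ j * cnj (w $ k))"
    by (rule sum.swap)
  also have "\<dots> = hdot u (adjoint_matrix A *v w)"
    by (simp add: hdot_def matrix_vector_mult_def adjoint_matrix_def sum_distrib_left mult_ac)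
  finally show ?thesis .
qed

lemma unitary_norm:
  assumes "unitary_matrix A"
  shows "norm (A *v u) = norm u" "norm (adjoint_matrix A *v u) = norm u"
proof -
  have *: "norm (A *v u) = norm u" for u
  proof -
    have "hdot (A *v u) (A *v u) = hdot u u"
      by (simp add: hdot_adjoint unitary_adjoint[OF assms])
    then have "(norm (A *v u))\<^sup>2 = (norm u)\<^sup>2"
      unfolding hdot_self using of_real_eq_iff by blast
    then show ?thesis by simp
  qed
  show "norm (A *v u) = norm u" by (rule *)
  show "norm (adjoint_matrix A *v u) = norm u"
    using *[of "adjoint_matrix A *v u"] by (simp add: unitary_adjoint[OF assms])
qed

lemma obtain_unitary_matrix:
  fixes p g :: "complex^'k::finite"
  assumes "norm p = 1" "norm g = 1" "hdot p g = 0" "i \<noteq> j"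
  obtains A where "unitary_matrix A" "A *v p = axis i 1" "A *v g = axis j 1"
proof -
  define f where "f = (\<lambda>k. if k = i then p else g)"
  have "orthonormal_on {i, j} f"
    using assms hdot_commute[of g p]
    by (auto simp: orthonormal_on_def f_def hdot_self)
  then obtain h where h: "orthonormal_on UNIV h" "h i = p" "h j = g"
    using orthonormal_extend[of "{i, j}" f] assms(4) by (auto simp: f_def)
  define A :: "complex^'k^'k" where "A = (\<chi> k l. cnj (h k $ l))"
  have Ah: "(A *v h k) $ l = (if k = l then 1 else 0)" for k l
  proof -
    have "(A *v h k) $ l = hdot (h k) (h l)"
      by (simp add: A_def hdot_def matrix_vector_mult_def mult.commute)
    then show ?thesis using h(1) by (simp add: orthonormal_on_def)
  qed
  have "A ** (\<chi> i j. cnj (A $ j $ i)) = mat 1"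
    using Ah by (simp add: vec_eq_iff matrix_matrix_mult_def mat_def A_def matrix_vector_mult_def)
  then have "unitary_matrix A"
    by (simp add: unitary_matrix_def matrix_left_right_inverse)
  moreover have "A *v p = axis i 1" "A *v g = axis j 1"
    unfolding h(2,3)[symmetric] by (simp_all add: vec_eq_iff Ah axis_def)
  ultimately show ?thesis using that by blast
qed

section \<open>Affine coordinates near a point\<close>

definition hom_coords :: "complex^'n \<Rightarrow> complex^('n::finite option)" where
  "hom_coords v = (\<chi> k. case k of None \<Rightarrow> 1 | Some i \<Rightarrow> v $ i)"

definition lin_coords :: "complex^'n \<Rightarrow> complex^('n::finite option)" where
  "lin_coords v = (\<chi> k. case k of None \<Rightarrow> 0 | Some i \<Rightarrow> v $ i)"

lemma sum_option:
  fixes f :: "'n::finite option \<Rightarrow> 'b::comm_monoid_add"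
  shows "(\<Sum>k\<in>UNIV. f k) = f None + (\<Sum>i\<in>UNIV. f (Some i))"
  by (simp add: UNIV_option_conv sum.reindex)

lemma norm_vec_sq: "(norm (u :: complex^'k))\<^sup>2 = (\<Sum>k\<in>UNIV. (cmod (u $ k))\<^sup>2)"
  by (simp add: norm_vec_def L2_set_def sum_nonneg)

lemma norm_axis: "norm (axis i x :: 'a::real_inner^'k) = norm x"
  by (simp add: norm_eq_sqrt_inner inner_axis_axis)

lemma norm_lin_coords: "norm (lin_coords v) = norm v"
proof -
  have "(norm (lin_coords v))\<^sup>2 = (norm v)\<^sup>2"
    unfolding norm_vec_sq sum_option by (simp add: lin_coords_def)
  then show ?thesis by simp
qed

lemma norm_hom_coords: "(norm (hom_coords v))\<^sup>2 = 1 + (norm v)\<^sup>2"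
  unfolding norm_vec_sq sum_option by (simp add: hom_coords_def)

lemma hom_coords_nonzero: "hom_coords v \<noteq> 0"
  by (auto simp: hom_coords_def vec_eq_iff intro!: exI[of _ None])

text \<open>
  If \<open>A\<close> is unitary and takes \<open>p\<close> to the last basis vector, then the cosine of the distance from
  \<open>[p]\<close> to \<open>[u]\<close> is \<open>1 / sqrt (1 + |v|\<^sup>2)\<close>, where \<open>v\<close> are the affine coordinates of the rotated point.  So the
  distance is \<open>arctan |v|\<close>, and a ball of radius \<open>arctan e\<close> is a coordinate ball of radius \<open>e\<close>.
\<close>

lemma chart_near_point:
  fixes p u :: "complex^('n::finite option)"
  assumes A: "unitary_matrix A" "A *v p = axis None 1" and p: "norm p = 1"
    and u: "u \<noteq> 0" and e: "e > 0" and d: "dist (abs_cp p) (abs_cp u) < arctan e"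
  defines "z \<equiv> rotate_cp A (abs_cp u)"
  shows "in_chart z" "norm (affine_coords z) < e"
    "\<exists>c. c \<noteq> 0 \<and> u = c *s (adjoint_matrix A *v hom_coords (affine_coords z))"
proof -
  define w where "w = A *v u"
  have w0: "w \<noteq> 0" and nw: "norm w = norm u"
    using unitary_norm[OF A(1), of u] u unfolding w_def by auto
  have z: "z = abs_cp w"
    using rotate_abs_cp[OF A(1) u] by (simp add: z_def w_def)
  have p0: "p \<noteq> 0" using p by auto
  have "hdot u p = hdot w (A *v p)"
    unfolding w_def by (simp add: hdot_adjoint unitary_adjoint[OF A(1)])
  also have "\<dots> = w $ None"
    unfolding A(2) hdot_def sum_option by (simp add: axis_def)
  finally have hw: "cmod (hdot p u) = cmod (w $ None)"
    by (subst hdot_commute) simp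
  have "dist (abs_cp p) (abs_cp u) = fs_dist p u"
    using p0 u by (simp add: dist_abs_cp)
  moreover have "0 \<le> dist (abs_cp p) (abs_cp u)" by simp
  moreover have "arctan e < pi / 2" by (rule arctan_ubound)
  ultimately have "cos (arctan e) < cos (fs_dist p u)"
    using d by (intro cos_monotone_0_pi) auto
  then have lt: "1 / sqrt (1 + e\<^sup>2) < cmod (w $ None) / norm w"
    unfolding cos_arctan cos_fs_dist[OF p0 u] hw by (simp add: p nw)
  moreover have "0 < 1 / sqrt (1 + e\<^sup>2)" by (simp add: add_pos_nonneg)
  ultimately have nz: "w $ None \<noteq> 0" by auto
  show "in_chart z" unfolding z using nz w0 by (simp add: in_chart.abs_eq proj_rel_refl)
  have ac: "affine_coords z = (\<chi> i. w $ Some i / w $ None)"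
    unfolding z using w0 by (simp add: affine_coords.abs_eq proj_rel_refl)
  have weq: "w = (w $ None) *s hom_coords (affine_coords z)"
    using nz by (auto simp: ac hom_coords_def vec_eq_iff split: option.splits)
  have "norm w = cmod (w $ None) * norm (hom_coords (affine_coords z))"
    by (subst weq) (rule norm_smult_vec)
  then have "cmod (w $ None) / norm w = 1 / norm (hom_coords (affine_coords z))"
    using nz w0 by (simp add: field_simps)
  moreover have "0 < norm (hom_coords (affine_coords z))"
    by (simp add: hom_coords_nonzero)
  ultimately have "norm (hom_coords (affine_coords z)) < sqrt (1 + e\<^sup>2)"
    using lt by (simp add: field_simps add_pos_nonneg)
  then have "(norm (hom_coords (affine_coords z)))\<^sup>2 < (sqrt (1 + e\<^sup>2))\<^sup>2"
    by (intro power_strict_mono) auto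
  then have "(norm (affine_coords z))\<^sup>2 < e\<^sup>2"
    by (simp add: norm_hom_coords)
  then show "norm (affine_coords z) < e"
    using e by (metis less_imp_le power_less_imp_less_base)
  have "u = adjoint_matrix A *v w"
    unfolding w_def by (simp add: unitary_adjoint[OF A(1)])
  also have "\<dots> = (w $ None) *s (adjoint_matrix A *v hom_coords (affine_coords z))"
    by (subst weq) (rule vector_scalar_commute)
  finally show "\<exists>c. c \<noteq> 0 \<and> u = c *s (adjoint_matrix A *v hom_coords (affine_coords z))"
    using nz by blast
qed

section \<open>From a cone condition to a Lipschitz graph\<close>

text \<open>
  The graph function is the supremum of all downward cones with vertex in \<open>S \<inter> N\<close>.  A supremum of
  \<open>M\<close>-Lipschitz functions is \<open>M\<close>-Lipschitz, so it is defined on the whole space even though \<open>S\<close> is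
  only known inside \<open>N\<close>.  Points of \<open>S\<close> lie strictly below it because \<open>S\<close> is open upwards, and points of \<open>N\<close>
  strictly below it lie in one of the cones.
\<close>

lemma subgraph_of_cone_condition:
  fixes S N :: "('a::metric_space \<times> real) set" and M :: real
  assumes M: "0 \<le> M" and bdd: "\<And>x t. (x, t) \<in> N \<Longrightarrow> t \<le> b" and ne: "S \<inter> N \<noteq> {}"
    and opn: "\<And>x t. (x, t) \<in> S \<inter> N \<Longrightarrow> \<exists>e>0. (x, t + e) \<in> S \<inter> N"
    and cone: "\<And>x t y s. (x, t) \<in> S \<inter> N \<Longrightarrow> (y, s) \<in> N \<Longrightarrow> s < t - M * dist x y \<Longrightarrow> (y, s) \<in> S"
  obtains \<phi> where "M-lipschitz_on UNIV \<phi>" "\<And>x t. (x, t) \<in> N \<Longrightarrow> (x, t) \<in> S \<longleftrightarrow> t < \<phi> x"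
proof -
  define \<phi> where "\<phi> = (\<lambda>x. SUP z\<in>S \<inter> N. snd z - M * dist (fst z) x)"
  have above: "bdd_above ((\<lambda>z. snd z - M * dist (fst z) x) ` (S \<inter> N))" for x
  proof (rule bdd_aboveI2[where M = b])
    fix z assume "z \<in> S \<inter> N"
    then have "snd z \<le> b" using bdd[of "fst z" "snd z"] by simp
    moreover have "0 \<le> M * dist (fst z) x" using M by simp
    ultimately show "snd z - M * dist (fst z) x \<le> b" by linarith
  qed
  have up: "\<phi> x \<le> \<phi> y + M * dist x y" for x y
    unfolding \<phi>_def
  proof (rule cSUP_least[OF ne])
    fix z assume z: "z \<in> S \<inter> N"
    have "M * dist (fst z) y \<le> M * (dist (fst z) x + dist x y)"
      using M by (intro mult_left_mono dist_triangle)
    then have "snd z - M * dist (fst z) x \<le> snd z - M * dist (fst z) y + M * dist x y"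
      by (simp add: algebra_simps)
    also have "snd z - M * dist (fst z) y \<le> (SUP z\<in>S \<inter> N. snd z - M * dist (fst z) y)"
      by (rule cSUP_upper[OF z above])
    finally show "snd z - M * dist (fst z) x
        \<le> (SUP z\<in>S \<inter> N. snd z - M * dist (fst z) y) + M * dist x y" by simp
  qed
  show ?thesis
  proof (rule that[of \<phi>])
    show "M-lipschitz_on UNIV \<phi>"
    proof (rule lipschitz_onI[OF _ M])
      fix x y
      show "dist (\<phi> x) (\<phi> y) \<le> M * dist x y"
        using up[of x y] up[of y x] by (simp add: dist_real_def dist_commute)
    qed
    fix x t assume N: "(x, t) \<in> N"
    show "(x, t) \<in> S \<longleftrightarrow> t < \<phi> x"
    proof
      assume "(x, t) \<in> S"
      then obtain e where e: "e > 0" "(x, t + e) \<in> S \<inter> N" using opn N by blast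
      have "t + e \<le> \<phi> x"
        unfolding \<phi>_def using cSUP_upper[OF e(2) above[of x]] by simp
      then show "t < \<phi> x" using e by simp
    next
      assume "t < \<phi> x"
      then obtain z where z: "z \<in> S \<inter> N" "t < snd z - M * dist (fst z) x"
        unfolding \<phi>_def using less_cSUP_iff[OF ne above] by blast
      then show "(x, t) \<in> S"
        using cone[of "fst z" "snd z" x t] N by simp
    qed
  qed
qed

text \<open>
  The cone condition for the set where \<open>q\<close> is positive, in the coordinates used for Lipschitz domains.  It is
  stable under unions, so a domain with corners can be treated one defining function at a time,
  provided that all of them share the vertical direction.
\<close>

definition cone_monotone_at_0 :: "(complex^('n::{finite,linorder}) \<Rightarrow> real) \<Rightarrow> real \<Rightarrow> real \<Rightarrow> bool" where
  "cone_monotone_at_0 q M \<epsilon> \<longleftrightarrow>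
     (\<forall>v w. norm v < \<epsilon> \<longrightarrow> norm w < \<epsilon> \<longrightarrow> 0 < q v \<longrightarrow>
        Im (w $ last_index) < Im (v $ last_index) -
          M * dist (first_coords v, Re (v $ last_index)) (first_coords w, Re (w $ last_index)) \<longrightarrow> 0 < q w)"

lemma cone_monotone_mono:
  assumes "cone_monotone_at_0 q M \<epsilon>" "M \<le> M'" "\<epsilon>' \<le> \<epsilon>"
  shows "cone_monotone_at_0 q M' \<epsilon>'"
  unfolding cone_monotone_at_0_def
proof (intro allI impI)
  fix v w :: "complex^('a::{finite,linorder})"
  let ?d = "dist (first_coords v, Re (v $ last_index)) (first_coords w, Re (w $ last_index))"
  assume a: "norm v < \<epsilon>'" "norm w < \<epsilon>'" "0 < q v"
    "Im (w $ last_index) < Im (v $ last_index) - M' * ?d"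
  have "M * ?d \<le> M' * ?d" using assms(2) by (intro mult_right_mono) auto
  then have "Im (w $ last_index) < Im (v $ last_index) - M * ?d" using a by linarith
  then show "0 < q w" using assms a unfolding cone_monotone_at_0_def by (meson less_le_trans)
qed

text \<open>
  A step \<open>h\<close> in a narrow downward cone is almost a multiple of the downward vertical vector, along
  which the derivative \<open>D\<close> at \<open>0\<close> is positive.  The error estimate is uniform in the starting point \<open>v\<close>;
  this is what allows both ends of the step to vary near \<open>0\<close>.
\<close>

lemma cone_monotone_strict_derivative:
  fixes q :: "complex^('n::{finite,linorder}) \<Rightarrow> real"
  assumes D: "bounded_linear D" "0 < D (axis last_index (- \<i>))"
    and q: "\<And>v h. \<bar>q (v + h) - q v - D h\<bar> \<le> C * (norm v + norm h) * norm h" and C: "0 \<le> C"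
  obtains M \<epsilon> where "0 \<le> M" "0 < \<epsilon>" "cone_monotone_at_0 q M \<epsilon>"
proof -
  define d where "d = D (axis last_index (- \<i>))"
  have d: "0 < d" using D(2) by (simp add: d_def)
  obtain B where B: "0 < B" "\<And>h. \<bar>D h\<bar> \<le> norm h * B"
    using bounded_linear.pos_bounded[OF D(1)] by auto
  \<comment> \<open>\<open>M\<close> makes the horizontal part of a step cost at most a quarter of the vertical gain,
    and \<open>\<epsilon>\<close> does the same for the nonlinear error.\<close>
  define M where "M = 2 + 8 * B / d"
  define \<epsilon> where "\<epsilon> = d / (24 * (C + 1))"
  have M: "2 \<le> M" "8 * B \<le> M * d" using B d by (simp_all add: M_def field_simps)
  have \<epsilon>: "0 < \<epsilon>" "C * (3 * \<epsilon>) \<le> d / 8"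
    using C d by (simp_all add: \<epsilon>_def field_simps)
  have "cone_monotone_at_0 q M \<epsilon>"
    unfolding cone_monotone_at_0_def
  proof (intro allI impI)
    fix v w :: "complex^('n::{finite,linorder})"
    define \<rho> where "\<rho> = dist (first_coords v, Re (v $ last_index)) (first_coords w, Re (w $ last_index))"
    define h where "h = w - v"
    define \<tau> where "\<tau> = - Im (h $ last_index)"
    \<comment> \<open>\<open>h\<close> is \<open>\<tau>\<close> times the downward vertical vector plus the horizontal part \<open>k\<close>.\<close>
    define k where "k = first_coords h + axis last_index (of_real (Re (h $ last_index)))"
    assume a: "norm v < \<epsilon>" "norm w < \<epsilon>" "0 < q v"
      "Im (w $ last_index) < Im (v $ last_index) - M * \<rho>"
    then have \<tau>: "M * \<rho> < \<tau>" by (simp add: \<tau>_def h_def)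
    have \<rho>0: "0 \<le> \<rho>" by (simp add: \<rho>_def)
    have "norm (first_coords h) = dist (first_coords v) (first_coords w)"
      unfolding dist_norm h_def by (subst norm_minus_commute, rule arg_cong[where f = norm])
         (simp add: first_coords_def vec_eq_iff)
    also have "\<dots> \<le> \<rho>"
      unfolding \<rho>_def using dist_fst_le[of "(first_coords v, Re (v $ last_index))" "(first_coords w, Re (w $ last_index))"] by simp
    finally have n1: "norm (first_coords h) \<le> \<rho>" .
    have "\<bar>Re (h $ last_index)\<bar> = dist (Re (v $ last_index)) (Re (w $ last_index))"
      by (simp add: h_def dist_real_def)
    also have "\<dots> \<le> \<rho>"
      unfolding \<rho>_def using dist_snd_le[of "(first_coords v, Re (v $ last_index))" "(first_coords w, Re (w $ last_index))"] by simp
    finally have n2: "\<bar>Re (h $ last_index)\<bar> \<le> \<rho>" .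
    have k: "norm k \<le> 2 * \<rho>"
      unfolding k_def using norm_triangle_ineq[of "first_coords h" "axis last_index (of_real (Re (h $ last_index)))"] n1 n2
      by (simp add: norm_axis)
    have hk: "h = \<tau> *\<^sub>R axis last_index (- \<i>) + k"
      by (auto simp: vec_eq_iff k_def \<tau>_def first_coords_def axis_def complex_eq_iff)
    have "2 * \<rho> \<le> M * \<rho>" using M \<rho>0 by (intro mult_right_mono) auto
    then have \<tau>k: "norm k \<le> \<tau>" and \<tau>0: "0 < \<tau>" using k \<tau> \<rho>0 by auto
    have h2: "norm h \<le> 2 * \<tau>"
      unfolding hk using norm_triangle_ineq[of "\<tau> *\<^sub>R axis last_index (- \<i>)" k] \<tau>k \<tau>0
      by (simp add: norm_axis)
    have "D h = \<tau> * d + D k"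
      unfolding hk d_def using D(1) by (simp add: linear_simps)
    moreover have "\<bar>D k\<bar> \<le> \<tau> * d / 4"
    proof -
      have "\<bar>D k\<bar> \<le> 2 * \<rho> * B" using B k by (meson less_imp_le mult_right_mono order_trans)
      moreover have "8 * B * \<rho> \<le> M * d * \<rho>" using M \<rho>0 by (intro mult_right_mono) auto
      moreover have "M * \<rho> * d \<le> \<tau> * d" using \<tau> d by simp
      ultimately show ?thesis by (simp add: mult_ac)
    qed
    moreover have "\<bar>q w - q v - D h\<bar> \<le> \<tau> * d / 4"
    proof -
      have "norm h \<le> 2 * \<epsilon>"
        unfolding h_def using norm_triangle_ineq4[of w v] a by simp
      then have "C * (norm v + norm h) \<le> C * (3 * \<epsilon>)"
        using a C by (intro mult_left_mono) auto
      also have "\<dots> \<le> d / 8" by (rule \<epsilon>)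
      finally have "C * (norm v + norm h) * norm h \<le> d / 8 * (2 * \<tau>)"
        using h2 d by (intro mult_mono) auto
      then show ?thesis using q[of v h] by (simp add: h_def mult_ac)
    qed
    moreover have "0 < \<tau> * d" using \<tau>0 d by simp
    ultimately have "q v \<le> q w" by linarith
    then show "0 < q w" using a by simp
  qed
  then show ?thesis using that[of M \<epsilon>] M \<epsilon> by linarith
qed

section \<open>The complement of a lens\<close>

text \<open>
  The polarisation of the quadratic form
  \<open>Q\<^sub>\<sigma>(u) = Re ((1 - \<sigma> \<i>) u\<^sub>n cnj u\<^sub>0) + |u'|\<^sup>2\<close>, where \<open>u\<^sub>n\<close> is the coordinate at \<open>Some last_index\<close>, \<open>u\<^sub>0\<close> the one at
  \<open>None\<close>, and \<open>u'\<close> collects the others.  It is the real part of a Hermitian form with one negative eigenvalue, so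
  for \<open>\<sigma> = \<plusminus>1\<close> the set \<open>Q\<^sub>\<sigma> \<le> 0\<close> is a closed projective ball.
\<close>

definition lens_form :: "real \<Rightarrow> complex^('n::{finite,linorder} option) \<Rightarrow> complex^('n option) \<Rightarrow> real" where
  "lens_form \<sigma> a b =
     Re (Complex 1 (- \<sigma>) * (a $ Some last_index * cnj (b $ None) + b $ Some last_index * cnj (a $ None))) / 2
     + (a \<bullet> b - a $ Some last_index \<bullet> b $ Some last_index - a $ None \<bullet> b $ None)"

lemma bounded_bilinear_lens_form: "bounded_bilinear (lens_form \<sigma>)"
  unfolding bilinear_conv_bounded_bilinear[symmetric] bilinear_def lens_form_def
  by (auto intro!: linearI simp: inner_simps algebra_simps add_divide_distrib diff_divide_distrib)

lemmas lens_form_simps =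
  bounded_bilinear.add_left[OF bounded_bilinear_lens_form] bounded_bilinear.add_right[OF bounded_bilinear_lens_form]
  bounded_bilinear.diff_left[OF bounded_bilinear_lens_form] bounded_bilinear.diff_right[OF bounded_bilinear_lens_form]
  bounded_bilinear.scaleR_left[OF bounded_bilinear_lens_form] bounded_bilinear.scaleR_right[OF bounded_bilinear_lens_form]
  bounded_bilinear.minus_left[OF bounded_bilinear_lens_form] bounded_bilinear.minus_right[OF bounded_bilinear_lens_form]

lemma lens_form_0: "lens_form \<sigma> 0 u = 0"
  by (simp add: bounded_bilinear.zero_left[OF bounded_bilinear_lens_form])

lemma lens_form_commute: "lens_form \<sigma> a b = lens_form \<sigma> b a"
  by (simp add: lens_form_def inner_commute add.commute)

lemma lens_form_self:
  "lens_form \<sigma> u u = Re (u $ Some last_index * cnj (u $ None)) + \<sigma> * Im (u $ Some last_index * cnj (u $ None))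
     + ((norm u)\<^sup>2 - (cmod (u $ Some last_index))\<^sup>2 - (cmod (u $ None))\<^sup>2)"
  by (simp add: lens_form_def power2_norm_eq_inner)

lemma lens_form_smult: "lens_form \<sigma> (c *s u) (c *s u) = (cmod c)\<^sup>2 * lens_form \<sigma> u u"
proof -
  have y: "(c *s u) $ Some last_index * cnj ((c *s u) $ None)
      = of_real ((cmod c)\<^sup>2) * (u $ Some last_index * cnj (u $ None))"
    unfolding complex_norm_square by simp
  show ?thesis
    unfolding lens_form_self y by (simp add: norm_smult_vec norm_mult power_mult_distrib algebra_simps)
qed

lemma norm_last_two: "(cmod (u $ Some last_index))\<^sup>2 + (cmod (u $ None))\<^sup>2 \<le> (norm u)\<^sup>2"
proof -
  have "(\<Sum>k\<in>{Some last_index, None}. (cmod (u $ k))\<^sup>2) \<le> (\<Sum>k\<in>UNIV. (cmod (u $ k))\<^sup>2)"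
    by (intro sum_mono2) auto
  then show ?thesis by (simp add: norm_vec_sq)
qed

text \<open>
  The complement of the intersection of the two closed balls \<open>Q\<^sub>1 \<le> 0\<close> and \<open>Q\<^sub>-\<^sub>1 \<le> 0\<close>.
\<close>

definition lens_complement :: "'n::{finite,linorder} cp set" where
  "lens_complement = abs_cp ` {u. 0 < lens_form 1 u u \<or> 0 < lens_form (- 1) u u}"

lemma abs_cp_eq_iff:
  assumes "u \<noteq> 0" "w \<noteq> 0"
  shows "abs_cp u = abs_cp w \<longleftrightarrow> (\<exists>c. c \<noteq> 0 \<and> w = c *s u)"
proof -
  have "abs_cp u = abs_cp w \<longleftrightarrow> fs_dist u w = 0"
    using assms dist_abs_cp by (metis dist_eq_0_iff)
  then show ?thesis using fs_dist_eq_0_iff[OF assms] assms by (simp add: proj_rel_def)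
qed

lemma abs_cp_in_lens_complement:
  assumes "u \<noteq> 0"
  shows "abs_cp u \<in> lens_complement \<longleftrightarrow> 0 < lens_form 1 u u \<or> 0 < lens_form (- 1) u u"
proof
  assume "abs_cp u \<in> lens_complement"
  then obtain w where w: "abs_cp u = abs_cp w" "0 < lens_form 1 w w \<or> 0 < lens_form (- 1) w w"
    unfolding lens_complement_def by blast
  then have "w \<noteq> 0" by (auto simp: lens_form_0)
  then obtain c where "c \<noteq> 0" "w = c *s u" using w assms abs_cp_eq_iff by blast
  then show "0 < lens_form 1 u u \<or> 0 < lens_form (- 1) u u"
    using w(2) by (auto simp: lens_form_smult zero_less_mult_iff)
qed (auto simp: lens_complement_def)

lemma continuous_on_lens_form:
  "continuous_on S f \<Longrightarrow> continuous_on S g \<Longrightarrow> continuous_on S (\<lambda>x. lens_form \<sigma> (f x) (g x))"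
  by (rule bounded_bilinear.continuous_on[OF bounded_bilinear_lens_form])

lemma open_lens_complement: "open lens_complement"
  unfolding lens_complement_def
  by (intro open_abs_cp_image open_Collect_disj open_Collect_less continuous_on_lens_form continuous_intros)
     (auto simp: lens_form_0)

text \<open>
  The vector \<open>b\<close> is positive for both forms.  If \<open>u\<close> is positive for one of them, then so is the whole
  segment from \<open>u\<close> to \<open>b\<close> or to \<open>-b\<close>: choose the sign that makes the mixed term nonnegative.  Both
  end points represent the same point \<open>[b]\<close>.
\<close>

lemma connected_lens_complement: "connected (lens_complement :: 'n::{finite,linorder} cp set)"
proof -
  define b :: "complex^('n option)" where
    "b = axis None 1 + axis (Some last_index) 1"
  have nb: "(norm b)\<^sup>2 = 2"
    unfolding power2_norm_eq_inner b_def by (simp add: inner_simps inner_axis_axis)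
  have b: "lens_form \<sigma> b b = 1" for \<sigma>
    unfolding lens_form_self nb by (simp add: b_def axis_def)
  define I :: "(real \<times> (complex^('n option))) set" where "I = {(\<sigma>, u). \<bar>\<sigma>\<bar> = 1 \<and> 0 < lens_form \<sigma> u u}"
  define v where "v = (\<lambda>(\<sigma>, u). if 0 \<le> lens_form \<sigma> u b then b else - b)"
  have pos: "0 < lens_form \<sigma> w w" if I: "(\<sigma>, u) \<in> I" and w: "w \<in> closed_segment u (v (\<sigma>, u))" for \<sigma> u w
  proof -
    obtain t where t: "0 \<le> t" "t \<le> 1" "w = (1 - t) *\<^sub>R u + t *\<^sub>R v (\<sigma>, u)"
      using w unfolding closed_segment_def by blast
    have "lens_form \<sigma> w w = (1 - t)\<^sup>2 * lens_form \<sigma> u u + t\<^sup>2 + 2 * (t * (1 - t)) * \<bar>lens_form \<sigma> u b\<bar>"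
      unfolding t(3) by (simp add: lens_form_simps lens_form_commute[of \<sigma> b u] v_def b algebra_simps power2_eq_square)
    moreover have "0 \<le> 2 * (t * (1 - t)) * \<bar>lens_form \<sigma> u b\<bar>" using t by simp
    moreover have "0 < (1 - t)\<^sup>2 * lens_form \<sigma> u u + t\<^sup>2"
      using I by (cases "t = 1") (auto simp: I_def intro: add_pos_nonneg)
    ultimately show ?thesis by linarith
  qed
  define P where "P = (\<lambda>x. abs_cp ` closed_segment (snd x) (v x))"
  have "connected (P x)" if "x \<in> I" for x
  proof -
    obtain \<sigma> u where x: "x = (\<sigma>, u)" by (cases x)
    have "closed_segment (snd x) (v x) \<subseteq> - {0}"
      using pos[of \<sigma> u] that x by (fastforce simp: lens_form_0)
    then show ?thesis
      unfolding P_def by (intro connected_continuous_image continuous_on_subset[OF continuous_on_abs_cp] connected_segment)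
  qed
  moreover have "abs_cp b \<in> P x" for x
  proof -
    have "b \<noteq> 0" using nb by auto
    then have "abs_cp ((- 1) *s b) = abs_cp b" by (intro abs_cp_smult) auto
    moreover have "(- 1) *s b = - b" by (simp add: vec_eq_iff)
    ultimately have "abs_cp (v x) = abs_cp b" by (auto simp: v_def split: prod.splits)
    then show ?thesis unfolding P_def by (metis ends_in_segment(2) imageI)
  qed
  then have "abs_cp b \<in> (\<Inter>x\<in>I. P x)" by blast
  then have "(\<Inter>x\<in>I. P x) \<noteq> {}" by blast
  ultimately have "connected (\<Union>x\<in>I. P x)"
    by (intro connected_Union) blast+
  moreover have "(\<Union>x\<in>I. P x) = lens_complement"
  proof
    show "(\<Union>x\<in>I. P x) \<subseteq> lens_complement"
    proof safe
      fix \<sigma> u z assume x: "(\<sigma>, u) \<in> I" "z \<in> P (\<sigma>, u)"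
      then obtain w where w: "z = abs_cp w" "w \<in> closed_segment u (v (\<sigma>, u))" by (auto simp: P_def)
      have "\<sigma> = 1 \<or> \<sigma> = - 1" using x(1) by (auto simp: I_def abs_if split: if_splits)
      then show "z \<in> lens_complement"
        using pos[OF x(1) w(2)] w(1) unfolding lens_complement_def by blast
    qed
    show "lens_complement \<subseteq> (\<Union>x\<in>I. P x)"
    proof
      fix z :: "'n cp" assume "z \<in> lens_complement"
      then obtain u where "z = abs_cp u" "0 < lens_form 1 u u \<or> 0 < lens_form (- 1) u u"
        unfolding lens_complement_def by blast
      then have "(1, u) \<in> I \<or> (- 1, u) \<in> I" and z: "z = abs_cp u" by (auto simp: I_def)
      moreover have "z \<in> P (\<sigma>, u)" for \<sigma> by (simp add: P_def z)
      ultimately show "z \<in> (\<Union>x\<in>I. P x)" by blast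
    qed
  qed
  ultimately show ?thesis by simp
qed

section \<open>The distance to the boundary near the corner\<close>

lemma arctan_le:
  assumes "0 \<le> (x::real)"
  shows "arctan x \<le> x"
proof -
  have "0 - arctan 0 \<le> x - arctan x"
  proof (rule DERIV_nonneg_imp_nondecreasing[OF assms])
    fix t :: real
    have "((\<lambda>t. t - arctan t) has_real_derivative (1 - inverse (1 + t\<^sup>2))) (at t)"
      by (auto intro!: derivative_eq_intros)
    moreover have "0 \<le> 1 - inverse (1 + t\<^sup>2)"
      using zero_le_power2[of t] by (simp add: inverse_eq_divide divide_le_eq_1 add_pos_nonneg del: zero_le_power2)
    ultimately show "\<exists>y. ((\<lambda>t. t - arctan t) has_real_derivative y) (at t) \<and> 0 \<le> y"
      by blast
  qed
  then show ?thesis by simp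
qed

lemma arctan_eq_arccos: "0 \<le> t \<Longrightarrow> arctan t = arccos (1 / sqrt (1 + t\<^sup>2))"
  by (simp add: arccos_cos less_imp_le[OF arctan_ubound] less_imp_le[OF less_le_trans[OF arctan_ubound]] flip: cos_arctan)

text \<open>
  The complex line through the corner \<open>ray_point 0\<close> in the direction of the last affine coordinate.
\<close>

definition ray_point :: "complex \<Rightarrow> 'n::{finite,linorder} cp" where
  "ray_point x = affine_point (axis last_index x)"

lemma ray_point_abs: "ray_point x = abs_cp (hom_coords (axis last_index x))"
  by (simp add: ray_point_def affine_point_def hom_coords_def)

lemma hom_axis:
  "hom_coords (axis last_index x) $ None = 1"
  "hom_coords (axis last_index x) $ Some i = (if i = last_index then x else 0)"
  "norm (hom_coords (axis last_index x)) = sqrt (1 + (cmod x)\<^sup>2)"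
proof -
  show "norm (hom_coords (axis last_index x)) = sqrt (1 + (cmod x)\<^sup>2)"
    using norm_hom_coords[of "axis last_index x"]
    by (intro real_sqrt_unique[symmetric]) (simp_all add: norm_axis)
qed (auto simp: hom_coords_def axis_def)

lemma ray_point_in_lens_complement:
  assumes "0 < Re x"
  shows "(ray_point x :: 'n::{finite,linorder} cp) \<in> lens_complement"
proof -
  let ?z = "hom_coords (axis last_index x) :: complex^('n option)"
  have "lens_form \<sigma> ?z ?z = Re x + \<sigma> * Im x" for \<sigma>
    unfolding lens_form_self hom_axis by simp
  then show ?thesis
    unfolding ray_point_abs abs_cp_in_lens_complement[OF hom_coords_nonzero] using assms by auto
qed

text \<open>
  Let \<open>k\<close> be a unit representative of \<open>w\<close> and \<open>y = k\<^sub>n cnj k\<^sub>0\<close>.  Since both forms are nonpositive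
  at \<open>k\<close>, \<open>y\<close> lies in the sector \<open>|Im y| \<le> - Re y\<close>, which makes an angle of at least a right angle
  with every \<open>x\<close> in the sector \<open>|Im x| \<le> Re x\<close>.  So the mixed term in
  \<open>|x cnj k\<^sub>n + cnj k\<^sub>0|\<^sup>2\<close> is nonpositive and this number is at most \<open>1\<close>, which is its value at the
  corner, whenever \<open>|x| \<le> 1\<close>.
\<close>

lemma dist_ray_point_ge:
  assumes x: "\<bar>Im x\<bar> \<le> Re x" "cmod x \<le> 1" and w: "w \<notin> lens_complement"
  shows "arctan (cmod x) \<le> dist (ray_point x) (w :: 'n::{finite,linorder} cp)"
proof -
  obtain k where k: "norm k = 1" "w = abs_cp k" using obtain_unit_rep .
  then have k0: "k \<noteq> 0" by auto
  define y where "y = k $ Some last_index * cnj (k $ None)"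
  let ?z = "hom_coords (axis last_index x) :: complex^('n option)"
  have n2: "(cmod (k $ Some last_index))\<^sup>2 + (cmod (k $ None))\<^sup>2 \<le> 1"
    using norm_last_two[of k] k by simp
  have "\<not> 0 < lens_form 1 k k" "\<not> 0 < lens_form (- 1) k k"
    using w abs_cp_in_lens_complement[OF k0] k(2) by auto
  then have y: "\<bar>Im y\<bar> \<le> - Re y"
    using n2 unfolding lens_form_self k(1) y_def[symmetric] by (simp add: abs_le_iff)
  have "Re (x * cnj y) \<le> 0"
  proof -
    have "Im x * Im y \<le> \<bar>Im x\<bar> * \<bar>Im y\<bar>" by (metis abs_ge_self abs_mult)
    also have "\<dots> \<le> Re x * (- Re y)" using x y by (intro mult_mono) auto
    finally show ?thesis by simp
  qed
  have hd: "hdot ?z k = x * cnj (k $ Some last_index) + cnj (k $ None)"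
    unfolding hdot_def sum_option hom_axis by (simp add: if_distrib[of "\<lambda>a. a * _"] cong: if_cong)
  have "(cmod (hdot ?z k))\<^sup>2 = (cmod x)\<^sup>2 * (cmod (k $ Some last_index))\<^sup>2 + (cmod (k $ None))\<^sup>2 + 2 * Re (x * cnj y)"
    unfolding hd cmod_power2 y_def by (simp add: algebra_simps power2_eq_square)
  also have "\<dots> \<le> 1 * (cmod (k $ Some last_index))\<^sup>2 + (cmod (k $ None))\<^sup>2 + 0"
    using x(2) \<open>Re (x * cnj y) \<le> 0\<close> by (intro add_mono mult_right_mono) (auto simp: power_le_one)
  finally have "(cmod (hdot ?z k))\<^sup>2 \<le> 1" using n2 by simp
  then have "cmod (hdot ?z k) \<le> 1" by (simp add: power_le_one_iff abs_square_le_1)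
  moreover have "0 < sqrt (1 + (cmod x)\<^sup>2)" by (simp add: add_pos_nonneg)
  ultimately have "cmod (hdot ?z k) / (norm ?z * norm k) \<le> 1 / sqrt (1 + (cmod x)\<^sup>2)"
    unfolding hom_axis k by (simp add: divide_right_mono)
  moreover have "1 / sqrt (1 + (cmod x)\<^sup>2) \<le> 1" by (simp add: divide_le_eq_1 add_pos_nonneg)
  moreover have "0 \<le> cmod (hdot ?z k) / (norm ?z * norm k)" by simp
  ultimately have "arccos (1 / sqrt (1 + (cmod x)\<^sup>2)) \<le> fs_dist ?z k"
    unfolding fs_dist_def by (intro arccos_le_arccos) linarith+
  then show ?thesis
    unfolding ray_point_abs k(2) by (simp add: arctan_eq_arccos dist_abs_cp hom_coords_nonzero k0)
qed

lemma dist_ray_point_corner: "dist (ray_point x) (ray_point 0 :: 'n::{finite,linorder} cp) = arctan (cmod x)"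
proof -
  have "hdot (hom_coords (axis last_index x)) (hom_coords (axis last_index 0) :: complex^('n option)) = 1"
    unfolding hdot_def sum_option hom_axis by simp
  then show ?thesis
    unfolding ray_point_abs by (simp add: dist_abs_cp hom_coords_nonzero fs_dist_def hom_axis arctan_eq_arccos)
qed

lemma corner_in_frontier: "ray_point 0 \<in> frontier (lens_complement :: 'n::{finite,linorder} cp set)"
proof -
  have "(ray_point 0 :: 'n cp) \<notin> lens_complement"
    unfolding ray_point_abs abs_cp_in_lens_complement[OF hom_coords_nonzero] lens_form_self hom_axis by simp
  moreover have "(ray_point 0 :: 'n cp) \<in> closure lens_complement"
    unfolding closure_approachable
  proof (intro allI impI)
    fix e :: real assume e: "0 < e"
    have "arctan (e / 2) < e" using e arctan_le[of "e / 2"] by simp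
    then show "\<exists>y\<in>lens_complement. dist y (ray_point 0 :: 'n cp) < e"
      using e by (intro bexI[of _ "ray_point (of_real (e / 2))"] ray_point_in_lens_complement) (auto simp: dist_ray_point_corner)
  qed
  ultimately show ?thesis
    by (simp add: frontier_def interior_open[OF open_lens_complement])
qed

lemma infdist_ray_point:
  assumes x: "\<bar>Im x\<bar> \<le> Re x" "cmod x \<le> 1"
  shows "infdist (ray_point x) (frontier lens_complement) = arctan (cmod x)"
proof (rule antisym)
  show "infdist (ray_point x) (frontier lens_complement) \<le> arctan (cmod x)"
    using infdist_le[OF corner_in_frontier, of "ray_point x"] by (simp add: dist_ray_point_corner)
  have "frontier lens_complement \<noteq> {}" using corner_in_frontier by blast
  then show "arctan (cmod x) \<le> infdist (ray_point x) (frontier lens_complement)"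
    unfolding infdist_def
    using x frontier_disjoint_eq[of lens_complement] open_lens_complement
    by (auto intro!: cINF_greatest dist_ray_point_ge)
qed

section \<open>The boundary of the lens is Lipschitz\<close>

lemma hom_coords_eq: "hom_coords v = axis None 1 + lin_coords v"
  by (auto simp: vec_eq_iff hom_coords_def lin_coords_def axis_def split: option.splits)

lemma bounded_linear_lin_coords: "bounded_linear (lin_coords :: complex^'n::finite \<Rightarrow> _)"
proof (rule bounded_linear_intro[where K = 1])
  show "lin_coords (x + y) = lin_coords x + lin_coords y" for x y :: "complex^'n"
    by (auto simp: vec_eq_iff lin_coords_def split: option.splits)
  show "lin_coords (r *\<^sub>R x) = r *\<^sub>R lin_coords x" for r and x :: "complex^'n"
    by (auto simp: vec_eq_iff lin_coords_def split: option.splits)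
qed (simp add: norm_lin_coords)

lemma bounded_linear_frame:
  "bounded_linear (\<lambda>v :: complex^'n::finite. adjoint_matrix A *v lin_coords v)"
proof -
  have "linear (\<lambda>u. adjoint_matrix A *v u)"
    by (intro linearI) (simp_all add: vec_eq_iff matrix_vector_mult_def scaleR_sum_right sum.distrib algebra_simps)
  then have "bounded_linear (\<lambda>u. adjoint_matrix A *v u)"
    by (simp add: linear_conv_bounded_linear)
  then show ?thesis
    by (rule bounded_linear_compose[OF _ bounded_linear_lin_coords])
qed

text \<open>
  In affine coordinates at \<open>p\<close> the form becomes a quadratic polynomial with value \<open>lens_form \<sigma> p p\<close> and
  derivative \<open>h \<mapsto> 2 lens_form \<sigma> p (A\<^sup>* h)\<close> at the origin, where \<open>A\<^sup>*\<close> is the adjoint matrix.  If the value is negative, the set where it is positive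
  does not come near \<open>p\<close> and the cone condition is vacuous.
\<close>

lemma lens_form_cone_monotone:
  fixes p :: "complex^('n::{finite,linorder} option)"
  assumes A: "unitary_matrix A" "A *v p = axis None 1"
    and p: "lens_form \<sigma> p p < 0 \<or> lens_form \<sigma> p p = 0 \<and> 0 < lens_form \<sigma> p (adjoint_matrix A *v lin_coords (axis last_index (- \<i>)))"
  defines "q \<equiv> \<lambda>v. lens_form \<sigma> (adjoint_matrix A *v hom_coords v) (adjoint_matrix A *v hom_coords v)"
  obtains M \<epsilon> where "0 \<le> M" "0 < \<epsilon>" "cone_monotone_at_0 q M \<epsilon>"
proof -
  define T where "T = (\<lambda>v :: complex^('n::{finite,linorder}). adjoint_matrix A *v lin_coords v)"
  have T: "bounded_linear T" unfolding T_def by (rule bounded_linear_frame)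
  have nT: "norm (T v) = norm v" for v
    by (simp add: T_def unitary_norm[OF A(1)] norm_lin_coords)
  have pA: "adjoint_matrix A *v axis None 1 = p"
    using unitary_adjoint(1)[OF A(1), of p] A(2) by simp
  have q: "q v = lens_form \<sigma> (p + T v) (p + T v)" for v
    by (simp add: q_def hom_coords_eq matrix_vector_right_distrib pA T_def)
  obtain C where C: "0 < C" "\<And>a b :: complex^('n option). \<bar>lens_form \<sigma> a b\<bar> \<le> norm a * norm b * C"
    using bounded_bilinear.pos_bounded[OF bounded_bilinear_lens_form[of \<sigma>]] unfolding real_norm_def by blast
  define D where "D = (\<lambda>h. 2 * lens_form \<sigma> p (T h))"
  have D: "bounded_linear D"
    unfolding D_def
    by (intro bounded_linear_const_mult bounded_linear_compose[OF bounded_bilinear.bounded_linear_right[OF bounded_bilinear_lens_form] T])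
  have qD: "\<bar>q (v + h) - q v - D h\<bar> \<le> (2 * C) * (norm v + norm h) * norm h" for v h
  proof -
    have "q (v + h) - q v - D h = 2 * lens_form \<sigma> (T v) (T h) + lens_form \<sigma> (T h) (T h)"
      unfolding q D_def
      by (simp add: linear_simps(1)[OF T] lens_form_simps lens_form_commute[of \<sigma> "T h" "T v"]
          lens_form_commute[of \<sigma> "T h" p] lens_form_commute[of \<sigma> "T v" p])
    then have "\<bar>q (v + h) - q v - D h\<bar> \<le> 2 * (norm v * norm h * C) + norm h * norm h * C"
      using C(2)[of "T v" "T h"] C(2)[of "T h" "T h"] by (simp add: nT)
    also have "\<dots> \<le> (2 * C) * (norm v + norm h) * norm h"
      using C(1) by (simp add: algebra_simps)
    finally show ?thesis .
  qed
  show ?thesis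
    using p
  proof
    assume neg: "lens_form \<sigma> p p < 0"
    have "continuous_on UNIV q"
      unfolding q by (intro continuous_on_lens_form continuous_intros linear_continuous_on T)
    then have "open {v. q v < 0}"
      by (intro open_Collect_less continuous_intros)
    moreover have "0 \<in> {v. q v < 0}"
      using neg by (simp add: q linear_simps(3)[OF T])
    ultimately obtain e where e: "e > 0" "ball 0 e \<subseteq> {v. q v < 0}"
      by (meson open_contains_ball)
    have "\<not> 0 < q v" if "norm v < e" for v
    proof -
      have "v \<in> ball 0 e" using that by simp
      then show ?thesis using e(2) by fastforce
    qed
    then have "cone_monotone_at_0 q 0 e" unfolding cone_monotone_at_0_def by blast
    then show ?thesis using that e(1) by blast
  next
    assume "lens_form \<sigma> p p = 0 \<and> 0 < lens_form \<sigma> p (adjoint_matrix A *v lin_coords (axis last_index (- \<i>)))"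
    then have "0 < D (axis last_index (- \<i>))" by (simp add: D_def T_def)
    then show ?thesis
      using cone_monotone_strict_derivative[OF D _ qD] C(1) that by auto
  qed
qed

text \<open>
  The vector \<open>h\<close> obtained from \<open>p\<close> by deleting \<open>p'\<close> and exchanging \<open>p\<^sub>n\<close> and \<open>p\<^sub>0\<close> satisfies
  \<open>2 lens_form \<sigma> p h = |p\<^sub>n|\<^sup>2 + |p\<^sub>0|\<^sup>2\<close> for both signs at once, so it points into the domain also at
  corners.  Its component along \<open>p\<close> is a real multiple \<open>m p\<close>, and subtracting it changes the
  derivative by \<open>m lens_form \<sigma> p p\<close>, which vanishes for every form that is active at \<open>p\<close>.
\<close>

lemma lens_complement_transversal:
  fixes p :: "complex^('n::{finite,linorder} option)"
  assumes p: "norm p = 1" "abs_cp p \<in> frontier lens_complement"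
  obtains g where "norm g = 1" "hdot p g = 0"
    "\<And>\<sigma>. \<bar>\<sigma>\<bar> = 1 \<Longrightarrow> lens_form \<sigma> p p < 0 \<or> lens_form \<sigma> p p = 0 \<and> 0 < lens_form \<sigma> p g"
proof -
  have p0: "p \<noteq> 0" using p by auto
  have "abs_cp p \<notin> lens_complement"
    using p(2) frontier_disjoint_eq[of "lens_complement :: 'n cp set"] open_lens_complement by blast
  then have le1: "lens_form 1 p p \<le> 0" "lens_form (- 1) p p \<le> 0"
    using abs_cp_in_lens_complement[OF p0] by auto
  have sig: "\<sigma> = 1 \<or> \<sigma> = - 1" if "\<bar>\<sigma>\<bar> = 1" for \<sigma> :: real
    using that by (auto simp: abs_if split: if_splits)
  have le: "lens_form \<sigma> p p \<le> 0" if "\<bar>\<sigma>\<bar> = 1" for \<sigma>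
    using sig[OF that] le1 by auto
  \<comment> \<open>Otherwise \<open>p\<close> would be an interior point of the lens.\<close>
  have zero: "lens_form 1 p p = 0 \<or> lens_form (- 1) p p = 0"
  proof (rule ccontr)
    assume "\<not> ?thesis"
    with le1 have neg: "lens_form 1 p p < 0 \<and> lens_form (- 1) p p < 0" by auto
    let ?V = "{u :: complex^('n option). lens_form 1 u u < 0 \<and> lens_form (- 1) u u < 0}"
    have "open ?V"
      by (intro open_Collect_conj open_Collect_less continuous_on_lens_form continuous_intros)
    moreover have "0 \<notin> ?V" by (simp add: lens_form_0)
    ultimately have "open (abs_cp ` ?V)" by (rule open_abs_cp_image)
    moreover have "abs_cp p \<in> abs_cp ` ?V" using neg by blast
    moreover have "abs_cp p \<in> closure lens_complement" using p(2) by (simp add: frontier_def)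
    ultimately obtain z where "z \<in> abs_cp ` ?V" "z \<in> lens_complement"
      unfolding closure_iff_nhds_not_empty by (meson disjoint_iff order_refl)
    then obtain u :: "complex^('n option)" where u: "lens_form 1 u u < 0" "lens_form (- 1) u u < 0" "abs_cp u \<in> lens_complement" by blast
    then have "u \<noteq> 0" by (auto simp: lens_form_0)
    from abs_cp_in_lens_complement[OF this] u show False by auto
  qed
  let ?n = "p $ Some last_index" and ?o = "p $ None"
  define a where "a = (cmod ?n)\<^sup>2 + (cmod ?o)\<^sup>2"
  have a: "0 < a"
  proof (rule ccontr)
    assume "\<not> 0 < a"
    then have "?n = 0 \<and> ?o = 0"
      unfolding a_def by (metis norm_eq_zero sum_power2_gt_zero_iff)
    then have "lens_form 1 p p = 1" unfolding lens_form_self p(1) by simp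
    then show False using le1 by simp
  qed
  define h :: "complex^('n option)" where "h = axis None ?n + axis (Some last_index) ?o"
  have h: "h $ None = ?n" "h $ Some last_index = ?o" by (simp_all add: h_def axis_def)
  have ph: "lens_form \<sigma> p h = a / 2" for \<sigma>
  proof -
    have "p \<bullet> h = ?o \<bullet> ?n + ?n \<bullet> ?o" by (simp add: h_def inner_simps inner_axis)
    then have "lens_form \<sigma> p h = Re (Complex 1 (- \<sigma>) * (?n * cnj ?n + ?o * cnj ?o)) / 2"
      unfolding lens_form_def h by simp
    also have "?n * cnj ?n + ?o * cnj ?o = of_real a"
      by (simp only: a_def of_real_add complex_norm_square)
    finally show ?thesis by simp
  qed
  define m where "m = 2 * Re (?n * cnj ?o)"
  have hp: "hdot h p = of_real m"
  proof -
    have "hdot h p = ?n * cnj ?o + (\<Sum>i\<in>UNIV. (if i = last_index then ?o else 0) * cnj (p $ Some i))"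
      unfolding hdot_def sum_option by (simp add: h_def axis_def)
    also have "\<dots> = ?n * cnj ?o + ?o * cnj ?n"
      by (simp add: if_distrib[of "\<lambda>a. a * _"] cong: if_cong)
    also have "\<dots> = of_real m" by (simp add: m_def complex_eq_iff)
    finally show ?thesis .
  qed
  define g0 where "g0 = h - m *\<^sub>R p"
  have "g0 = h - of_real m *s p" by (simp add: g0_def vec_eq_iff scaleR_conv_of_real[symmetric])
  then have "hdot g0 p = 0" by (simp add: hdot_simps hp hdot_self p)
  then have g0p: "hdot p g0 = 0" by (subst hdot_commute) simp
  have pg0: "lens_form \<sigma> p g0 = a / 2" if "lens_form \<sigma> p p = 0" for \<sigma>
    using that by (simp add: g0_def lens_form_simps ph)
  have "g0 \<noteq> 0"
    using zero pg0 a by (auto simp: bounded_bilinear.zero_right[OF bounded_bilinear_lens_form])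
  show ?thesis
  proof (rule that[of "inverse (norm g0) *\<^sub>R g0"])
    show "norm (inverse (norm g0) *\<^sub>R g0) = 1" using \<open>g0 \<noteq> 0\<close> by simp
    have "inverse (norm g0) *\<^sub>R g0 = complex_of_real (inverse (norm g0)) *s g0"
      unfolding vec_eq_iff by (simp add: scaleR_conv_of_real[where 'a = complex])
    then show "hdot p (inverse (norm g0) *\<^sub>R g0) = 0" by (simp add: hdot_simps g0p)
    fix \<sigma> :: real assume "\<bar>\<sigma>\<bar> = 1"
    then show "lens_form \<sigma> p p < 0 \<or> lens_form \<sigma> p p = 0 \<and> 0 < lens_form \<sigma> p (inverse (norm g0) *\<^sub>R g0)"
      using le[of \<sigma>] pg0[of \<sigma>] a \<open>g0 \<noteq> 0\<close> by (auto simp: lens_form_simps)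
  qed
qed

text \<open>
  At a boundary point choose the unitary map so that the transversal direction becomes the downward
  vertical one.  The two forms then satisfy cone conditions with common constants, hence so does
  the union of their positive sets.
\<close>

lemma lipschitz_domain_lens_complement: "lipschitz_domain (lens_complement :: 'n::{finite,linorder} cp set)"
  unfolding lipschitz_domain_def
proof (intro conjI ballI)
  have "ray_point 1 \<in> (lens_complement :: 'n cp set)" by (rule ray_point_in_lens_complement) simp
  then show "domain_cp (lens_complement :: 'n cp set)"
    unfolding domain_cp_def using open_lens_complement connected_lens_complement corner_in_frontier by blast
  fix P :: "'n cp" assume P: "P \<in> frontier lens_complement"
  obtain p where p: "norm p = 1" "P = abs_cp p" using obtain_unit_rep .
  have p0: "p \<noteq> 0" using p by auto
  obtain g where g: "norm g = 1" "hdot p g = 0"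
    "\<And>\<sigma>. \<bar>\<sigma>\<bar> = 1 \<Longrightarrow> lens_form \<sigma> p p < 0 \<or> lens_form \<sigma> p p = 0 \<and> 0 < lens_form \<sigma> p g"
    using lens_complement_transversal P p by metis
  \<comment> \<open>The factor \<open>\<i>\<close> sends \<open>g\<close> to \<open>-\<i>\<close> times the last coordinate vector: the domain lies below the graph.\<close>
  have "norm (\<i> *s g) = 1" "hdot p (\<i> *s g) = 0" using g by (simp_all add: norm_smult_vec hdot_simps)
  then obtain A where A: "unitary_matrix A" "A *v p = axis None 1" "A *v (\<i> *s g) = axis (Some last_index) 1"
    using obtain_unitary_matrix[OF p(1), of "\<i> *s g" None "Some last_index"] by auto
  have Ag: "adjoint_matrix A *v lin_coords (axis last_index (- \<i>)) = g"
  proof -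
    have "lin_coords (axis last_index (- \<i>)) = (- \<i>) *s (A *v (\<i> *s g))"
      unfolding A(3) by (auto simp: vec_eq_iff lin_coords_def axis_def split: option.splits)
    then have "adjoint_matrix A *v lin_coords (axis last_index (- \<i>))
        = (- \<i>) *s (adjoint_matrix A *v (A *v (\<i> *s g)))"
      by (simp only: vector_scalar_commute)
    then show ?thesis by (simp add: unitary_adjoint[OF A(1)] vector_smult_assoc)
  qed
  define q where "q = (\<lambda>\<sigma> v. lens_form \<sigma> (adjoint_matrix A *v hom_coords v) (adjoint_matrix A *v hom_coords v))"
  have ex: "\<exists>M \<epsilon>. 0 \<le> M \<and> 0 < \<epsilon> \<and> cone_monotone_at_0 (q \<sigma>) M \<epsilon>" if "\<bar>\<sigma>\<bar> = 1" for \<sigma>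
  proof (rule lens_form_cone_monotone[OF A(1,2)])
    show "lens_form \<sigma> p p < 0 \<or> lens_form \<sigma> p p = 0 \<and>
        0 < lens_form \<sigma> p (adjoint_matrix A *v lin_coords (axis last_index (- \<i>)))"
      unfolding Ag by (rule g(3)[OF that])
  qed (unfold q_def, blast)
  obtain M1 e1 M2 e2 where 1: "0 \<le> M1" "0 < e1" "cone_monotone_at_0 (q 1) M1 e1"
    and 2: "0 \<le> M2" "0 < e2" "cone_monotone_at_0 (q (- 1)) M2 e2"
    using ex[of 1] ex[of "- 1"] by auto
  define M where "M = max M1 M2"
  define e where "e = min e1 e2"
  have M: "0 \<le> M" and e: "0 < e" using 1 2 by (auto simp: M_def e_def)
  have cm: "cone_monotone_at_0 (q 1) M e" "cone_monotone_at_0 (q (- 1)) M e"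
    using 1 2 by (auto simp: M_def e_def intro: cone_monotone_mono)
  define pos where "pos = (\<lambda>v. 0 < q 1 v \<or> 0 < q (- 1) v)"
  define \<Psi> where "\<Psi> = (\<lambda>v :: complex^('n::{finite,linorder}). ((first_coords v, Re (v $ last_index)), Im (v $ last_index)))"
  have inj: "v = w" if "\<Psi> v = \<Psi> w" for v w
  proof -
    have "v $ i = w $ i" for i
    proof (cases "i = last_index")
      case True then show ?thesis using that by (simp add: \<Psi>_def complex_eq_iff)
    next
      case False
      then have "v $ i = first_coords v $ i" "w $ i = first_coords w $ i" by (simp_all add: first_coords_def)
      then show ?thesis using that by (simp add: \<Psi>_def)
    qed
    then show ?thesis by (simp add: vec_eq_iff)
  qed
  define S where "S = \<Psi> ` {v. pos v}"
  define N where "N = \<Psi> ` {v. norm v < e}"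
  have SI: "\<Psi> v \<in> S \<longleftrightarrow> pos v" and NI: "\<Psi> v \<in> N \<longleftrightarrow> norm v < e" for v
    using inj unfolding S_def N_def by blast+
  have chart: "in_chart (rotate_cp A z)" "norm (affine_coords (rotate_cp A z)) < e"
    "z \<in> lens_complement \<longleftrightarrow> pos (affine_coords (rotate_cp A z))" if z: "z \<in> ball P (arctan e)" for z
  proof -
    obtain u where "norm u = 1" and u: "z = abs_cp u" using obtain_unit_rep .
    then have u0: "u \<noteq> 0" by auto
    have d: "dist (abs_cp p) (abs_cp u) < arctan e" using z p u by simp
    note c = chart_near_point[OF A(1,2) p(1) u0 e d]
    show "in_chart (rotate_cp A z)" "norm (affine_coords (rotate_cp A z)) < e" using c by (simp_all add: u)
    obtain c where "c \<noteq> 0" "u = c *s (adjoint_matrix A *v hom_coords (affine_coords (rotate_cp A z)))"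
      using c(3) u by blast
    then have "lens_form \<sigma> u u = (cmod c)\<^sup>2 * q \<sigma> (affine_coords (rotate_cp A z))" "0 < (cmod c)\<^sup>2" for \<sigma>
      by (simp_all add: q_def lens_form_smult)
    then show "z \<in> lens_complement \<longleftrightarrow> pos (affine_coords (rotate_cp A z))"
      unfolding u abs_cp_in_lens_complement[OF u0] by (simp add: pos_def zero_less_mult_iff)
  qed
  have "continuous_on UNIV (q \<sigma>)" for \<sigma>
    unfolding q_def hom_coords_eq matrix_vector_right_distrib
    by (intro continuous_on_lens_form continuous_intros linear_continuous_on bounded_linear_frame)
  then have "open {v. pos v \<and> norm v < e}"
    unfolding pos_def
    by (intro open_Collect_conj open_Collect_disj open_Collect_less continuous_intros)
  then have opn: "\<exists>d>0. pos (v + d *\<^sub>R axis last_index \<i>) \<and> norm (v + d *\<^sub>R axis last_index \<i>) < e"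
    if v: "pos v" "norm v < e" for v
  proof -
    obtain r where r: "r > 0" "ball v r \<subseteq> {v. pos v \<and> norm v < e}"
      using \<open>open _\<close> v by (metis (mono_tags, lifting) mem_Collect_eq open_contains_ball)
    have "v + (r / 2) *\<^sub>R axis last_index \<i> \<in> ball v r"
      using r(1) by (simp add: dist_norm norm_axis)
    then show ?thesis using r by (intro exI[of _ "r / 2"]) auto
  qed
  have ne: "S \<inter> N \<noteq> {}"
  proof -
    have "P \<in> closure lens_complement" using P by (simp add: frontier_def)
    moreover have "0 < arctan e" using e by simp
    ultimately obtain z where "z \<in> lens_complement" "dist z P < arctan e"
      unfolding closure_approachable by blast
    then have "\<Psi> (affine_coords (rotate_cp A z)) \<in> S \<inter> N"
      using chart[of z] by (simp add: SI NI dist_commute)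
    then show ?thesis by blast
  qed
  obtain \<phi> where \<phi>: "M-lipschitz_on UNIV \<phi>" "\<And>x t. (x, t) \<in> N \<Longrightarrow> (x, t) \<in> S \<longleftrightarrow> t < \<phi> x"
  proof (rule subgraph_of_cone_condition[OF M _ ne])
    fix x t assume "(x, t) \<in> N"
    then obtain v where "\<Psi> v = (x, t)" "norm v < e" unfolding N_def by (metis (mono_tags, lifting) imageE mem_Collect_eq)
    then show "t \<le> e"
      using abs_Im_le_cmod[of "v $ last_index"] Finite_Cartesian_Product.norm_nth_le[of v last_index] by (auto simp: \<Psi>_def)
  next
    fix x t assume "(x, t) \<in> S \<inter> N"
    then obtain v where v: "\<Psi> v = (x, t)" "norm v < e" unfolding N_def by (metis (mono_tags, lifting) IntD2 imageE mem_Collect_eq)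
    then have "pos v" using SI[of v] \<open>(x, t) \<in> S \<inter> N\<close> by simp
    then obtain d where d: "d > 0" "pos (v + d *\<^sub>R axis last_index \<i>)" "norm (v + d *\<^sub>R axis last_index \<i>) < e"
      using opn v(2) by blast
    have "\<Psi> (v + d *\<^sub>R axis last_index \<i>) = (x, t + d)"
      using v(1) by (auto simp: \<Psi>_def first_coords_def vec_eq_iff axis_def)
    then show "\<exists>d>0. (x, t + d) \<in> S \<inter> N"
      using d SI[of "v + d *\<^sub>R axis last_index \<i>"] NI[of "v + d *\<^sub>R axis last_index \<i>"] by auto
  next
    fix x t y s assume a: "(x, t) \<in> S \<inter> N" "(y, s) \<in> N" "s < t - M * dist x y"
    then obtain v where v: "\<Psi> v = (x, t)" "norm v < e" unfolding N_def by (metis (mono_tags, lifting) IntD2 imageE mem_Collect_eq)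
    then have "pos v" using SI[of v] a by simp
    obtain w where w: "\<Psi> w = (y, s)" "norm w < e" using a(2) unfolding N_def by (metis (mono_tags, lifting) imageE mem_Collect_eq)
    have "Im (w $ last_index) < Im (v $ last_index) -
          M * dist (first_coords v, Re (v $ last_index)) (first_coords w, Re (w $ last_index))"
      using a(3) v(1) w(1) by (auto simp: \<Psi>_def)
    then have "pos w"
      using \<open>pos v\<close> cm v(2) w(2) unfolding pos_def cone_monotone_at_0_def by meson
    then show "(y, s) \<in> S" using SI[of w] w(1) by simp
  qed blast
  show "\<exists>A R L (\<phi> :: (complex^('n::{finite,linorder})) \<times> real \<Rightarrow> real).
        unitary_matrix A \<and> rotate_cp A P = abs_cp (axis None 1) \<and>
        0 < R \<and> (\<forall>z\<in>ball P R. in_chart (rotate_cp A z)) \<and>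
        L-lipschitz_on ({v. v $ last_index = 0} \<times> UNIV) \<phi> \<and>
        lens_complement \<inter> ball P R =
          {z \<in> ball P R. let w = affine_coords (rotate_cp A z) in
             Im (w $ last_index) < \<phi> (first_coords w, Re (w $ last_index))}"
  proof (intro exI conjI)
    show "unitary_matrix A" by (rule A)
    show "rotate_cp A P = abs_cp (axis None 1)"
      unfolding p(2) rotate_abs_cp[OF A(1) p0] A(2) ..
    show "0 < arctan e" using e by simp
    show "\<forall>z\<in>ball P (arctan e). in_chart (rotate_cp A z)" using chart by blast
    show "M-lipschitz_on ({v. v $ last_index = 0} \<times> UNIV) \<phi>"
      using \<phi>(1) lipschitz_on_subset by blast
    have "z \<in> lens_complement \<longleftrightarrow> Im (affine_coords (rotate_cp A z) $ last_index)
        < \<phi> (first_coords (affine_coords (rotate_cp A z)), Re (affine_coords (rotate_cp A z) $ last_index))"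
      if z: "z \<in> ball P (arctan e)" for z
      using chart[OF z] \<phi>(2) SI[of "affine_coords (rotate_cp A z)"] NI[of "affine_coords (rotate_cp A z)"]
      by (simp add: \<Psi>_def)
    then show "lens_complement \<inter> ball P (arctan e) =
          {z \<in> ball P (arctan e). let w = affine_coords (rotate_cp A z) in
             Im (w $ last_index) < \<phi> (first_coords w, Re (w $ last_index))}"
      unfolding Let_def by blast
  qed
qed


section \<open>Circle means\<close>

text \<open>
  The mean value property of the harmonic function \<open>ln |z|\<close> on a disc that avoids the origin: the
  imaginary part of Cauchy's integral formula for \<open>Ln\<close>.
\<close>

lemma circle_mean_ln:
  assumes "0 \<le> s" "s < x"
  shows "((\<lambda>\<theta>. ln (cmod (of_real x + of_real s * cis \<theta>))) has_integral (2 * pi * ln x)) {0..2*pi}"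
proof (cases "s = 0")
  case True
  have "((\<lambda>\<theta>::real. ln x) has_integral (2 * pi * ln x)) {0..2*pi}"
    using has_integral_const_real[of "ln x" 0 "2 * pi"] by simp
  with True show ?thesis using assms by simp
next
  case False
  with assms have s: "s > 0" "x > 0" by auto
  have re: "Re (of_real x + of_real s * z) > 0" if "cmod z \<le> 1" for z
  proof -
    have "\<bar>Re z\<bar> \<le> 1" using that abs_Re_le_cmod[of z] by linarith
    then have "s * (- Re z) \<le> s * 1" using s by (intro mult_left_mono) auto
    then show ?thesis using assms by simp
  qed
  have nz: "of_real x + of_real s * z \<notin> \<real>\<^sub>\<le>\<^sub>0" if "cmod z \<le> 1" for z
    using re[OF that] by (auto simp: complex_nonpos_Reals_iff)
  have "(\<lambda>z. Ln (of_real x + of_real s * z)) holomorphic_on cball 0 1"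
    by (intro holomorphic_intros) (use nz in auto)
  then have "((\<lambda>u. Ln (of_real x + of_real s * u) / (u - 0)) has_contour_integral
      2 * of_real pi * \<i> * Ln (of_real x + of_real s * 0)) (circlepath 0 1)"
    by (intro Cauchy_integral_circlepath_simple) auto
  then have "((\<lambda>t. Ln (of_real x + of_real s * cis t) * \<i>) has_integral
      2 * of_real pi * \<i> * Ln (of_real x)) {0..2*pi}"
    unfolding circlepath_def
    by (subst (asm) has_contour_integral_part_circlepath_iff) (auto simp: divide_simps)
  then have "((\<lambda>t. Im (Ln (of_real x + of_real s * cis t) * \<i>)) has_integral
      Im (2 * of_real pi * \<i> * Ln (of_real x))) {0..2*pi}"
    by (rule has_integral_linear[OF _ bounded_linear_Im, unfolded o_def])
  moreover have "Im (Ln (of_real x + of_real s * cis t) * \<i>) = ln (cmod (of_real x + of_real s * cis t))" for t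
  proof -
    have "of_real x + of_real s * cis t \<noteq> 0" using nz[of "cis t"] by auto
    then show ?thesis by (simp add: Re_Ln)
  qed
  ultimately show ?thesis
    using s by (simp add: Ln_of_real)
qed

text \<open>
  Convexity of \<open>\<psi> powr \<eta>\<close> as a function of \<open>ln (tan \<psi>)\<close>, in the form of a strict tangent inequality.  The
  derivative with respect to \<open>ln (tan \<psi>)\<close> is \<open>\<eta> / 2\<close> times the function \<open>g\<close> below, and \<open>g\<close> increases as
  long as \<open>cos (2 \<psi>) > 1 - \<eta>\<close>, because \<open>sin (2 \<psi>) \<le> 2 \<psi>\<close>.
\<close>

lemma powr_above_tangent:
  fixes \<eta> \<rho> \<phi> :: real
  assumes \<eta>: "0 < \<eta>" "\<eta> < 1" and \<rho>: "0 < \<rho>" "\<rho> \<le> pi / 4" "1 - \<eta> < cos (2 * \<rho>)"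
    and \<phi>: "0 < \<phi>" "\<phi> < \<rho>"
  obtains c where
    "\<And>\<psi>. 0 < \<psi> \<Longrightarrow> \<psi> < \<rho> \<Longrightarrow> \<psi> \<noteq> \<phi> \<Longrightarrow> \<phi> powr \<eta> + c * (ln (tan \<psi>) - ln (tan \<phi>)) < \<psi> powr \<eta>"
proof -
  define g where "g = (\<lambda>t::real. t powr (\<eta> - 1) * sin (2 * t))"
  have g_mono: "g a < g b" if "0 < a" "a < b" "b < \<rho>" for a b
  proof (rule DERIV_pos_imp_increasing_open[OF that(2)])
    fix t assume t: "a < t" "t < b"
    then have t0: "0 < t" "t < \<rho>" using that by auto
    have "(g has_real_derivative ((\<eta> - 1) * t powr (\<eta> - 1 - 1) * sin (2 * t)
        + 2 * cos (2 * t) * t powr (\<eta> - 1))) (at t)"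
      unfolding g_def using t0 by (auto intro!: derivative_eq_intros)
    moreover have "(\<eta> - 1) * t powr (\<eta> - 1 - 1) * sin (2 * t) + 2 * cos (2 * t) * t powr (\<eta> - 1)
        = t powr (\<eta> - 2) * (2 * t * cos (2 * t) - (1 - \<eta>) * sin (2 * t))"
      using t0 powr_add[of t "\<eta> - 2" 1] by (simp add: algebra_simps)
    moreover have "0 < 2 * t * cos (2 * t) - (1 - \<eta>) * sin (2 * t)"
    proof -
      have "cos (2 * \<rho>) \<le> cos (2 * t)"
        using t0 \<rho> by (intro cos_monotone_0_pi_le) auto
      then have "0 < 2 * t * (cos (2 * t) - (1 - \<eta>))" using t0 \<rho> by simp
      moreover have "(1 - \<eta>) * sin (2 * t) \<le> (1 - \<eta>) * (2 * t)"
        using \<eta> t0 by (intro mult_left_mono sin_x_le_x) auto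
      ultimately show ?thesis by (simp add: algebra_simps)
    qed
    ultimately show "\<exists>y. (g has_real_derivative y) (at t) \<and> 0 < y"
      using t0 by auto
  next
    show "continuous_on {a..b} g"
      unfolding g_def using that by (intro continuous_intros) auto
  qed
  define c where "c = \<eta> * g \<phi> / 2"
  define D where "D = (\<lambda>t. t powr \<eta> - c * ln (tan t))"
  have sc: "0 < sin t" "0 < cos t" if "0 < t" "t < \<rho>" for t
    using that \<rho> by (auto intro!: sin_gt_zero cos_gt_zero)
  have D: "(D has_real_derivative (\<eta> * (g t - g \<phi>) / sin (2 * t))) (at t)" if t: "0 < t" "t < \<rho>" for t
  proof -
    have "(D has_real_derivative (\<eta> * t powr (\<eta> - 1) - c * (inverse ((cos t)\<^sup>2) / tan t))) (at t)"
      unfolding D_def using sc[OF t] t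
      by (auto intro!: derivative_eq_intros simp: tan_def field_simps power2_eq_square)
    moreover have "inverse ((cos t)\<^sup>2) / tan t = 2 / sin (2 * t)"
      unfolding sin_double using sc[OF t] by (simp add: tan_def field_simps power2_eq_square)
    moreover have "\<eta> * t powr (\<eta> - 1) = \<eta> * g t / sin (2 * t)"
      using sc[OF t] by (simp add: g_def sin_double)
    moreover have "c * (2 / sin (2 * t)) = \<eta> * g \<phi> / sin (2 * t)"
      by (simp add: c_def)
    moreover have "\<eta> * g t / sin (2 * t) - \<eta> * g \<phi> / sin (2 * t) = \<eta> * (g t - g \<phi>) / sin (2 * t)"
      by (simp add: diff_divide_distrib right_diff_distrib)
    ultimately show ?thesis by metis
  qed
  have s2: "0 < sin (2 * t)" if "0 < t" "t < \<rho>" for t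
    using sc[OF that] by (simp add: sin_double)
  have "D \<phi> < D \<psi>" if \<psi>: "0 < \<psi>" "\<psi> < \<rho>" "\<psi> \<noteq> \<phi>" for \<psi>
  proof (cases "\<phi> < \<psi>")
    case True
    show ?thesis
    proof (rule DERIV_pos_imp_increasing_open[OF True])
      fix t assume "\<phi> < t" "t < \<psi>"
      then show "\<exists>y. (D has_real_derivative y) (at t) \<and> 0 < y"
        using D[of t] g_mono[of \<phi> t] s2[of t] \<psi> \<phi> \<eta> by (intro exI[of _ "\<eta> * (g t - g \<phi>) / sin (2 * t)"] conjI) auto
    next
      show "continuous_on {\<phi>..\<psi>} D"
        using \<psi> \<phi> by (intro DERIV_atLeastAtMost_imp_continuous_on) (meson D order.strict_trans1 order.strict_trans2)
    qed
  next
    case False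
    then have lt: "\<psi> < \<phi>" using \<psi> by simp
    show ?thesis
    proof (rule DERIV_neg_imp_decreasing_open[OF lt])
      fix t assume "\<psi> < t" "t < \<phi>"
      then show "\<exists>y. (D has_real_derivative y) (at t) \<and> y < 0"
        using D[of t] g_mono[of t \<phi>] s2[of t] \<psi> \<phi> \<eta>
        by (intro exI[of _ "\<eta> * (g t - g \<phi>) / sin (2 * t)"] conjI) (auto simp: divide_neg_pos mult_pos_neg)
    next
      show "continuous_on {\<psi>..\<phi>} D"
        using \<psi> \<phi> by (intro DERIV_atLeastAtMost_imp_continuous_on) (meson D order.strict_trans1 order.strict_trans2)
    qed
  qed
  then show ?thesis
    by (intro that[of c]) (auto simp: D_def algebra_simps)
qed

text \<open>
  Integrate the tangent inequality at \<open>\<phi> = arctan x\<close> with \<open>\<psi> = arctan R\<close>, where \<open>R\<close> is the modulus on the circle: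
  the mean of \<open>ln R\<close> is \<open>ln x\<close>, so the linear term drops out.  Equality is impossible because the
  inequality is strict at the angle \<open>0\<close>.
\<close>

lemma circle_mean_arctan_powr:
  fixes \<eta> :: real
  assumes \<eta>: "0 < \<eta>" "\<eta> < 1"
  obtains r where "0 < r"
    "\<And>x s. 0 < s \<Longrightarrow> s < x \<Longrightarrow> x + s < r \<Longrightarrow>
       2 * pi * arctan x powr \<eta> <
       integral {0..2*pi} (\<lambda>\<theta>. arctan (cmod (of_real x + of_real s * cis \<theta>)) powr \<eta>)"
proof -
  have "((\<lambda>\<rho>::real. cos (2 * \<rho>)) \<longlongrightarrow> cos (2 * 0)) (at_right 0)"
    by (intro tendsto_intros)
  then have "\<forall>\<^sub>F \<rho> in at_right 0. 1 - \<eta> < cos (2 * \<rho>)"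
    by (rule order_tendstoD) (use \<eta> in simp)
  moreover have "\<forall>\<^sub>F \<rho> in at_right (0::real). \<rho> < pi / 4"
    by (intro order_tendstoD(2)[OF tendsto_ident_at]) simp
  moreover have "\<forall>\<^sub>F \<rho> in at_right (0::real). 0 < \<rho>"
    by (rule eventually_at_right_less)
  ultimately have "\<forall>\<^sub>F \<rho> in at_right (0::real). 1 - \<eta> < cos (2 * \<rho>) \<and> \<rho> < pi / 4 \<and> 0 < \<rho>"
    by eventually_elim auto
  then obtain \<rho> where \<rho>: "1 - \<eta> < cos (2 * \<rho>)" "\<rho> < pi / 4" "0 < \<rho>"
    using eventually_happens' trivial_limit_at_right_real by (metis (mono_tags, lifting))
  show ?thesis
  proof (rule that[of "tan \<rho>"])
    show "0 < tan \<rho>" using \<rho> by (intro tan_gt_zero) auto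
    fix x s :: real assume xs: "0 < s" "s < x" "x + s < tan \<rho>"
    define R where "R = (\<lambda>\<theta>. cmod (of_real x + of_real s * cis \<theta>))"
    have R: "0 < R \<theta>" "R \<theta> < tan \<rho>" for \<theta>
    proof -
      have "x - s \<le> R \<theta>" "R \<theta> \<le> x + s"
        using norm_diff_ineq[of "of_real x" "of_real s * cis \<theta>"]
          norm_triangle_ineq[of "of_real x" "of_real s * cis \<theta>"] xs
        by (simp_all add: R_def norm_mult)
      then show "0 < R \<theta>" "R \<theta> < tan \<rho>" using xs by auto
    qed
    have arc: "0 < arctan y" "arctan y < \<rho>" if "0 < y" "y < tan \<rho>" for y
      using that \<rho> arctan_monotone[OF that(2)] by (auto simp: arctan_tan)
    obtain c where c: "\<And>\<psi>. 0 < \<psi> \<Longrightarrow> \<psi> < \<rho> \<Longrightarrow> \<psi> \<noteq> arctan x \<Longrightarrow>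
        arctan x powr \<eta> + c * (ln (tan \<psi>) - ln (tan (arctan x))) < \<psi> powr \<eta>"
      using powr_above_tangent[OF \<eta> \<rho>(3) _ \<rho>(1), of "arctan x"] \<rho>(2) arc[of x] xs by auto
    define T where "T = (\<lambda>\<theta>. arctan x powr \<eta> + c * (ln (R \<theta>) - ln x))"
    have lt: "T \<theta> < arctan (R \<theta>) powr \<eta>" if "R \<theta> \<noteq> x" for \<theta>
      using c[of "arctan (R \<theta>)"] arc[OF R] that by (simp add: T_def tan_arctan arctan_eq_iff)
    have le: "T \<theta> \<le> arctan (R \<theta>) powr \<eta>" for \<theta>
      using lt[of \<theta>] by (cases "R \<theta> = x") (auto simp: T_def)
    have "((\<lambda>\<theta>. arctan x powr \<eta> + c * (ln (R \<theta>) - ln x)) has_integral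
        (2 * pi * (arctan x powr \<eta>) + c * (2 * pi * ln x - 2 * pi * ln x))) {0..2*pi}"
      using circle_mean_ln[of s x] xs has_integral_const_real[of "ln x" 0 "2 * pi"]
        has_integral_const_real[of "arctan x powr \<eta>" 0 "2 * pi"] unfolding R_def
      by (intro has_integral_add has_integral_mult_right has_integral_diff) auto
    then have T: "(T has_integral (2 * pi * arctan x powr \<eta>)) {0..2*pi}"
      by (simp add: T_def)
    have contR: "continuous_on {0..2*pi} R"
      unfolding R_def by (intro continuous_intros)
    have contT: "continuous_on {0..2*pi} T"
      unfolding T_def using R by (intro continuous_intros contR) (auto simp: less_imp_neq[symmetric])
    have contF: "continuous_on {0..2*pi} (\<lambda>\<theta>. arctan (R \<theta>) powr \<eta>)"
      using R by (intro continuous_intros contR) (auto simp: less_imp_neq[symmetric])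
    have "integral {0..2*pi} T < integral {0..2*pi} (\<lambda>\<theta>. arctan (R \<theta>) powr \<eta>)"
    proof -
      have "\<not> integral {0..2*pi} (\<lambda>\<theta>. arctan (R \<theta>) powr \<eta> - T \<theta>) = 0"
      proof
        assume z: "integral {0..2*pi} (\<lambda>\<theta>. arctan (R \<theta>) powr \<eta> - T \<theta>) = 0"
        have ct: "continuous_on {0..2*pi} (\<lambda>\<theta>. arctan (R \<theta>) powr \<eta> - T \<theta>)"
          by (intro continuous_intros contF contT)
        have "arctan (R 0) powr \<eta> - T 0 = 0"
          using z le pi_gt_zero integrable_integral[OF integrable_continuous_real[OF ct]]
          by (intro has_integral_0_cbox_imp_0[of 0 "2 * pi" "\<lambda>\<theta>. arctan (R \<theta>) powr \<eta> - T \<theta>"])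
             (auto simp: ct simp del: pi_gt_zero)
        moreover have "R 0 \<noteq> x" using xs by (simp add: R_def flip: of_real_add)
        ultimately show False using lt[of 0] by simp
      qed
      moreover have "integral {0..2*pi} (\<lambda>\<theta>. arctan (R \<theta>) powr \<eta> - T \<theta>) \<ge> 0"
        using le by (intro integral_nonneg integrable_continuous_real continuous_intros contF contT) auto
      moreover have "integral {0..2*pi} (\<lambda>\<theta>. arctan (R \<theta>) powr \<eta> - T \<theta>)
          = integral {0..2*pi} (\<lambda>\<theta>. arctan (R \<theta>) powr \<eta>) - integral {0..2*pi} T"
        by (intro integral_diff integrable_continuous_real contF contT)
      ultimately show ?thesis by linarith
    qed
    then show "2 * pi * arctan x powr \<eta> <
       integral {0..2*pi} (\<lambda>\<theta>. arctan (cmod (of_real x + of_real s * cis \<theta>)) powr \<eta>)"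
      using integral_unique[OF T] by (simp add: R_def)
  qed
qed

section \<open>Failure of plurisubharmonicity\<close>

lemma unitary_mat_1: "unitary_matrix (mat 1 :: complex^'k^'k)"
proof -
  have "(\<chi> i j. cnj ((mat 1 :: complex^'k^'k) $ j $ i)) = mat 1"
    by (auto simp: mat_def vec_eq_iff)
  then show ?thesis by (simp add: unitary_matrix_def)
qed

lemma rotate_cp_mat_1: "rotate_cp (mat 1) (affine_point v) = affine_point v"
proof -
  from rotate_abs_cp[OF unitary_mat_1 hom_coords_nonzero, of v] show ?thesis
    by (simp add: affine_point_def hom_coords_def)
qed

theorem proposition1p3:
  shows "\<exists>\<Omega> :: 'n::{finite,linorder} cp set.
    lipschitz_domain \<Omega> \<and>
    (\<forall>U \<eta>. open U \<longrightarrow> frontier \<Omega> \<subseteq> U \<longrightarrow> 0 < \<eta> \<longrightarrow> \<eta> < 1 \<longrightarrow>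
       \<not> psh_on_cp (U \<inter> \<Omega>) (\<lambda>z. - (infdist z (frontier \<Omega>) powr \<eta>)))"
proof (intro exI[of _ lens_complement] conjI allI impI notI lipschitz_domain_lens_complement)
  fix U :: "'n cp set" and \<eta> :: real
  assume U: "open U" "frontier lens_complement \<subseteq> U" and \<eta>: "0 < \<eta>" "\<eta> < 1"
    and psh: "psh_on_cp (U \<inter> lens_complement) (\<lambda>z. - (infdist z (frontier lens_complement) powr \<eta>))"
  obtain r where r: "0 < r"
    "\<And>x s. 0 < s \<Longrightarrow> s < x \<Longrightarrow> x + s < r \<Longrightarrow>
       2 * pi * arctan x powr \<eta> <
       integral {0..2*pi} (\<lambda>\<theta>. arctan (cmod (of_real x + of_real s * cis \<theta>)) powr \<eta>)"
    using circle_mean_arctan_powr[OF \<eta>] by blast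
  have "ray_point 0 \<in> U" using corner_in_frontier U(2) by blast
  then obtain e where e: "0 < e" "ball (ray_point 0) e \<subseteq> U" using U(1) open_contains_ball by blast
  define x where "x = min (min r e) 1 / 2"
  define s where "s = x / 4"
  have x: "0 < x" "2 * x \<le> r" "2 * x \<le> e" "2 * x \<le> 1" using r e by (auto simp: x_def)
  have pt: "\<bar>Im w\<bar> \<le> Re w" "0 < Re w" "cmod w \<le> 1" "cmod w < e"
    if "cmod \<zeta> \<le> 1" "w = of_real x + of_real s * \<zeta>" for \<zeta> w
  proof -
    have "cmod (of_real s * \<zeta>) \<le> s" using that(1) x by (simp add: norm_mult s_def)
    then have "\<bar>Re (of_real s * \<zeta>)\<bar> \<le> s" "\<bar>Im (of_real s * \<zeta>)\<bar> \<le> s" "cmod w \<le> x + s"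
      using abs_Re_le_cmod[of "of_real s * \<zeta>"] abs_Im_le_cmod[of "of_real s * \<zeta>"]
        norm_triangle_ineq[of "of_real x" "of_real s * \<zeta>"] x by (auto simp: that(2))
    then show "\<bar>Im w\<bar> \<le> Re w" "0 < Re w" "cmod w \<le> 1" "cmod w < e"
      using x by (auto simp: that(2) s_def)
  qed
  define a :: "complex^('n::{finite,linorder})" where "a = axis last_index (of_real x)"
  define b :: "complex^('n::{finite,linorder})" where "b = axis last_index (of_real s)"
  have line: "affine_point (a + \<zeta> *s b) = ray_point (of_real x + of_real s * \<zeta>)" for \<zeta>
    unfolding ray_point_def a_def b_def
    by (rule arg_cong[where f = affine_point]) (auto simp: vec_eq_iff axis_def)
  have mem: "affine_point (a + \<zeta> *s b) \<in> U \<inter> lens_complement" if "cmod \<zeta> \<le> 1" for \<zeta>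
  proof -
    have "dist (ray_point 0) (ray_point (of_real x + of_real s * \<zeta>) :: 'n cp) < e"
      unfolding dist_commute[of "ray_point 0"] dist_ray_point_corner using arctan_le[of "cmod (of_real x + of_real s * \<zeta>)"] pt(4)[OF that refl]
      by simp
    then show ?thesis
      unfolding line using e(2) ray_point_in_lens_complement[OF pt(2)[OF that refl]] by auto
  qed
  have val: "infdist (affine_point (a + \<zeta> *s b)) (frontier lens_complement)
      = arctan (cmod (of_real x + of_real s * \<zeta>))" if "cmod \<zeta> \<le> 1" for \<zeta>
    unfolding line using pt[OF that refl] by (intro infdist_ray_point)
  have "psh_on {v. affine_point v \<in> U \<inter> lens_complement}
      (\<lambda>v. - (infdist (affine_point v) (frontier lens_complement) powr \<eta>))"
    using psh[unfolded psh_on_cp_def, rule_format, OF unitary_mat_1] by (simp only: rotate_cp_mat_1)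
  then have int: "set_integrable lborel {0..2*pi}
        (\<lambda>\<theta>. - (infdist (affine_point (a + cis \<theta> *s b)) (frontier lens_complement) powr \<eta>))"
    and mean: "- (infdist (affine_point a) (frontier lens_complement) powr \<eta>)
      \<le> (1 / (2*pi)) * (LINT \<theta>:{0..2*pi}|lborel.
          - (infdist (affine_point (a + cis \<theta> *s b)) (frontier lens_complement) powr \<eta>))"
    unfolding psh_on_def using mem by blast+
  let ?I = "integral {0..2*pi} (\<lambda>\<theta>. arctan (cmod (of_real x + of_real s * cis \<theta>)) powr \<eta>)"
  have "(LINT \<theta>:{0..2*pi}|lborel.
          - (infdist (affine_point (a + cis \<theta> *s b)) (frontier lens_complement) powr \<eta>)) = - ?I"
    using set_borel_integral_eq_integral(2)[OF int] by (simp add: val)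
  moreover have "infdist (affine_point a) (frontier lens_complement) = arctan x"
    using val[of 0] x by simp
  ultimately have "- (arctan x powr \<eta>) \<le> (1 / (2*pi)) * (- ?I)" using mean by simp
  then have "?I \<le> 2 * pi * arctan x powr \<eta>" by (simp add: field_simps)
  moreover have "2 * pi * arctan x powr \<eta> < ?I"
    using x by (intro r(2)) (auto simp: s_def)
  ultimately show False by simp
qed

end
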